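(* Let $d\ge2$, $n\ge2$, and let $G_t=(V_t,E_t)$ be a simple undirected graph with $V_t=\{1,\dots,n\}$ and $m=|E_t|$. Let $\{\mathbf{t}_i^0\}_{i\in V_t}\subseteq\mathbb{R}^d$ be locations in generic position up to the normalization $\mathrm{Tr}(T_0)=1$, $\mathrm{Tr}(HT_0)=0$ (that is, obtained from a generic point set by a common translation and scaling so that $\sum_i\|\mathbf{t}_i^0\|_2^2=1$ and $\sum_i\mathbf{t}_i^0=\mathbf{0}$), where $T_0=\mathbf{t}^0(\mathbf{t}^0)^T$ and $\mathbf{t}^0\in\mathbb{R}^{dn}$ is the vector with $i$-th $d\times 1$ block $\mathbf{t}_i^0$. Assume that the noiseless formation $\{\Gamma^0_{ij}\}_{(i,j)\in E_t}$, $\Gamma_{ij}^0=\gamma_{ij}^0(\gamma_{ij}^0)^T$, $\gamma_{ij}^0=\frac{\mathbf{t}_i^0-\mathbf{t}_j^0}{\|\mathbf{t}_i^0-\mathbf{t}_j^0\|_2}$, is parallel rigid. Let $\epsilon\ge0$ and suppose noisy measurements $\Gamma_{ij}=\gamma_{ij}\gamma_{ij}^T$, $(i,j)\in E_t$, are given with $\gamma_{ij}=\gamma^0_{ij}+\epsilon_{ij}$, $\|\epsilon_{ij}\|_2\le\epsilon$ and $\|\gamma_{ij}\|_2=1$. Let $L$ be the Laplacian built from $Q_{ij}=I_d-\Gamma_{ij}$, let $T^*$ be a solution of $$\min_{T\in\mathbb{R}^{dn\times dn}}\ \mathrm{Tr}(LT)\quad\text{subject to}\quad \mathrm{Tr}(C^{ij}T)\ge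 1\ \ \forall (i,j)\in E_t,\quad \mathrm{Tr}(HT)=0,\quad T\succeq 0,$$ and let $\hat{\mathbf{t}}$ be a normalized (unit) eigenvector of $T^*$ corresponding to its largest eigenvalue. Then $$\min_{a\in\mathbb{R}}\|a\hat{\mathbf{t}}-\mathbf{t}^0\|_2\le\epsilon\left[\frac{\pi d(n-1)}{2}\left(\alpha_1+\left(\alpha_1^2+2\alpha_2\right)^{1/2}\right)\right],$$ where $$\alpha_1=\frac{\sqrt2\,m}{\lambda_{d+2}(L^0)},\qquad \alpha_2=\left(\frac{\kappa\sqrt d\,\|L_G\|_F}{m}+1\right)\frac{\lambda_n(L_G)}{\lambda_{d+2}(L^0)},\qquad \kappa=\Big(\min_{(i,j)\in E_t}\|\mathbf{t}^0_i-\mathbf{t}^0_j\|_2^2\Big)^{-1},$$ $L^0$ is the Laplacian built from $Q^0_{ij}=I_d-\Gamma^0_{ij}$, and $L_G$ is the graph Laplacian of $G_t$.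
   Context: Matrices of size $dn\times dn$ are viewed as $n\times n$ arrays of $d\times d$ blocks; $T\succeq0$ means symmetric positive semidefinite; $\|\cdot\|_F$ is the Frobenius norm; for a symmetric $N\times N$ matrix $A$, $\lambda_1(A)\le\dots\le\lambda_N(A)$ are its eigenvalues in ascending order. Generic point set: the $dn$ coordinates are algebraically independent, i.e. no non-zero polynomial with integer coefficients vanishes at them. Laplacian: given symmetric $Q_{ij}=Q_{ji}\in\mathbb{R}^{d\times d}$ for $(i,j)\in E_t$, the associated Laplacian in $\mathbb{R}^{dn\times dn}$ has blocks $-Q_{ij}$ at $(i,j)\in E_t$, $\sum_{k:(i,k)\in E_t}Q_{ik}$ at $(i,i)$, and $0$ otherwise. The graph Laplacian is $L_G=D_G-A_G\in\mathbb{R}^{n\times n}$ (degree matrix minus adjacency matrix). Each undirected edge is counted once (with a fixed orientation used to define $\gamma_{ij}^0$, $\gamma_{ij}$). Constraint matrices: for $(i,j)\in E_t$, $C^{ij}\in\mathbb{R}^{dn\times dn}$ has $(i,i)$ and $(j,j)$ blocks $I_d$, $(i,j)$ and $(j,i)$ blocks $-I_d$, all other blocks $0$. $H=J_n\otimes I_d$, $J_n$ the $n\times n$ all-ones matrix. Parallel rigidity: for pairwise distinct points $\mathbf{p}_1,\dots,\mathbf{p}_n\in\mathbb{R}^d$, the formation with lines $\Gamma_{ij}=(\mathbf{p}_i-\mathbf{p}_j)(\mathbf{p}_i-\mathbf{p}_j)^T/\|\mathbf{p}_i-\mathbf{p}_j\|_2^2$, $(i,j)\in E_t$, is parallel rigid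 if every set of pairwise distinct points $\mathbf{q}_1,\dots,\mathbf{q}_n\in\mathbb{R}^d$ with $\mathbf{q}_i-\mathbf{q}_j$ parallel to $\mathbf{p}_i-\mathbf{p}_j$ for all $(i,j)\in E_t$ satisfies $\mathbf{q}_i=c\mathbf{p}_i+\mathbf{x}$ for all $i$, for some $c\in\mathbb{R}\setminus\{0\}$, $\mathbf{x}\in\mathbb{R}^d$. Equivalently, the linear system $(I_d-\Gamma_{ij})(\mathbf{q}_i-\mathbf{q}_j)=0$, $(i,j)\in E_t$, in $\mathbf{q}\in\mathbb{R}^{dn}$ has a solution space of dimension exactly $d+1$. *)

theory Defs
  imports
    "HOL-Analysis.Analysis"
    "HOL-Library.Multiset"
    "HOL-Library.Poly_Mapping"
    "HOL-Computational_Algebra.Polynomial"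
begin

text \<open>
  Vertices are the elements of a finite type \<open>'n\<close>, coordinates those of a finite type \<open>'d\<close>, so
  \<open>n = CARD('n)\<close> and \<open>d = CARD('d)\<close>.  A vector of length \<open>dn\<close> is indexed by \<open>'n \<times> 'd\<close>, the entry
  \<open>(i, a)\<close> being coordinate \<open>a\<close> of block \<open>i\<close>.  The Frobenius norm of a matrix is
  \<open>norm\<close>, since \<open>norm\<close> on \<open>real^'m^'k\<close> is the Euclidean norm of the entries.
\<close>

definition stack :: "('n::finite \<Rightarrow> real^'d) \<Rightarrow> real^('n \<times> 'd)"
  where "stack t = (\<chi> p. t (fst p) $ snd p)"

definition block_matrix :: "('n::finite \<Rightarrow> 'n \<Rightarrow> real^'d^'d) \<Rightarrow> real^('n \<times> 'd)^('n \<times> 'd)"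
  where "block_matrix B = (\<chi> p q. B (fst p) (fst q) $ snd p $ snd q)"

definition kron :: "real^'n::finite^'n \<Rightarrow> real^'d^'d \<Rightarrow> real^('n \<times> 'd)^('n \<times> 'd)"
  where "kron A B = block_matrix (\<lambda>i j. (A $ i $ j) *\<^sub>R B)"

definition outer :: "real^'k \<Rightarrow> real^'k \<Rightarrow> real^'k^'k"
  where "outer v w = (\<chi> i j. v $ i * w $ j)"

definition psd :: "real^'k^'k \<Rightarrow> bool"
  where "psd T \<longleftrightarrow> transpose T = T \<and> (\<forall>x. 0 \<le> x \<bullet> (T *v x))"

definition charpoly :: "real^'k^'k \<Rightarrow> real poly"
  where "charpoly A = det (\<chi> i j. (if i = j then [:0, 1:] else 0) - [:A $ i $ j:])"

text \<open>
  \<open>eigval A k\<close> is the \<open>k\<close>-th smallest eigenvalue (counted from \<open>1\<close>, with multiplicity); it is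
  meaningful for symmetric \<open>A\<close>, all of whose eigenvalues are real, and \<open>1 \<le> k \<le> CARD('k)\<close>.
\<close>
definition eigval :: "real^'k^'k \<Rightarrow> nat \<Rightarrow> real"
  where "eigval A k = sorted_list_of_multiset (proots (charpoly A)) ! (k - 1)"

text \<open>Integer polynomials in the variables \<open>'k\<close> are finitely supported maps from monomials to
  coefficients, monomials being finitely supported exponent maps.\<close>
definition mpoly_eval :: "(('k \<Rightarrow>\<^sub>0 nat) \<Rightarrow>\<^sub>0 int) \<Rightarrow> real^'k \<Rightarrow> real"
  where "mpoly_eval P x =
    (\<Sum>m\<in>Poly_Mapping.keys P.
       of_int (Poly_Mapping.lookup P m) * (\<Prod>k\<in>UNIV. (x $ k) ^ Poly_Mapping.lookup m k))"

definition generic :: "('n::finite \<Rightarrow> real^'d) \<Rightarrow> bool"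
  where "generic p \<longleftrightarrow>
    (\<forall>P :: (('n \<times> 'd) \<Rightarrow>\<^sub>0 nat) \<Rightarrow>\<^sub>0 int. P \<noteq> 0 \<longrightarrow> mpoly_eval P (stack p) \<noteq> 0)"

definition simple_graph :: "'n set set \<Rightarrow> bool"
  where "simple_graph E \<longleftrightarrow> (\<forall>e\<in>E. card e = 2)"

text \<open>An orientation picks exactly one ordered pair for each edge.\<close>
definition orientation :: "'n set set \<Rightarrow> ('n \<times> 'n) set \<Rightarrow> bool"
  where "orientation E D \<longleftrightarrow> bij_betw (\<lambda>(i, j). {i, j}) D E"

definition laplacian ::
    "'n::finite set set \<Rightarrow> ('n \<Rightarrow> 'n \<Rightarrow> real^'d^'d) \<Rightarrow> real^('n \<times> 'd)^('n \<times> 'd)"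
  where "laplacian E Q = block_matrix (\<lambda>i j.
    if i = j then \<Sum>k | {i, k} \<in> E. Q i k
    else if {i, j} \<in> E then - Q i j
    else 0)"

definition adjacency_matrix :: "'n set set \<Rightarrow> real^'n^'n"
  where "adjacency_matrix E = (\<chi> i j. if {i, j} \<in> E then 1 else 0)"

definition degree_matrix :: "'n set set \<Rightarrow> real^'n^'n"
  where "degree_matrix E = (\<chi> i j. if i = j then real (card {e \<in> E. i \<in> e}) else 0)"

definition graph_laplacian :: "'n set set \<Rightarrow> real^'n^'n"
  where "graph_laplacian E = degree_matrix E - adjacency_matrix E"

definition constraint_matrix :: "'n::finite \<Rightarrow> 'n \<Rightarrow> real^('n \<times> 'd::finite)^('n \<times> 'd)"
  where "constraint_matrix i j = block_matrix (\<lambda>k l.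
    if k = l \<and> k \<in> {i, j} then mat 1
    else if {k, l} = {i, j} then - mat 1
    else 0)"

definition H_matrix :: "real^('n::finite \<times> 'd::finite)^('n \<times> 'd)"
  where "H_matrix = kron (\<chi> i j. 1) (mat 1)"

definition direction :: "('n \<Rightarrow> real^'d) \<Rightarrow> 'n \<Rightarrow> 'n \<Rightarrow> real^'d"
  where "direction t i j = (t i - t j) /\<^sub>R norm (t i - t j)"

text \<open>The lines of the formation enter only through the requirement that \<open>q i - q j\<close> be parallel
  to \<open>p i - p j\<close>.\<close>
definition parallel_rigid :: "'n set set \<Rightarrow> ('n \<Rightarrow> real^'d) \<Rightarrow> bool"
  where "parallel_rigid E p \<longleftrightarrow> inj p \<and>
    (\<forall>q :: 'n \<Rightarrow> real^'d.
       inj q \<and> (\<forall>i j. {i, j} \<in> E \<longrightarrow> (\<exists>s. q i - q j = s *\<^sub>R (p i - p j))) \<longrightarrow>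
       (\<exists>c x. c \<noteq> 0 \<and> (\<forall>i. q i = c *\<^sub>R p i + x)))"

definition sdp_feasible :: "'n::finite set set \<Rightarrow> real^('n \<times> 'd::finite)^('n \<times> 'd) \<Rightarrow> bool"
  where "sdp_feasible E T \<longleftrightarrow>
    (\<forall>i j. {i, j} \<in> E \<longrightarrow> trace (constraint_matrix i j ** T) \<ge> 1) \<and>
    trace (H_matrix ** T) = 0 \<and> psd T"

definition sdp_solution ::
    "'n::finite set set \<Rightarrow> real^('n \<times> 'd::finite)^('n \<times> 'd) \<Rightarrow> real^('n \<times> 'd)^('n \<times> 'd) \<Rightarrow> bool"
  where "sdp_solution E L T \<longleftrightarrow> is_arg_min (\<lambda>T. trace (L ** T)) (sdp_feasible E) T"

end

theory Submission
  imports Defs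
begin

text \<open>
  Write \<open>\<tau>\<close> for the trace of the solution \<open>T\<close>, \<open>\<mu>\<close> for its largest eigenvalue, \<open>\<Lambda>\<close> for the largest
  eigenvalue of the graph Laplacian and \<open>\<lambda>\<close> for the eigenvalue of \<open>L0\<close> with index \<open>d + 2\<close>.
  Rigidity makes the kernel of \<open>L0\<close> the span of \<open>t0\<close> and the translations, so \<open>\<lambda> > 0\<close> and, as \<open>T\<close>
  is orthogonal to the translations, \<open>\<lambda> (\<tau> - \<langle>t0, T t0\<rangle>) \<le> Tr (L0 T)\<close>.
  For unit vectors \<open>g\<close>, \<open>h\<close> at distance at most \<open>\<epsilon>\<close> the squared distances of \<open>w\<close> to the lines
  through \<open>g\<close> and \<open>h\<close> satisfy \<open>dist_g(w)^2 \<le> 2 dist_h(w)^2 + 2 \<epsilon>^2 |w|^2\<close>; summed over the edges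
  this gives \<open>Tr (L0 T) \<le> 2 Tr (L T) + 2 \<epsilon>^2 \<Lambda> \<tau>\<close>.  Since \<open>\<kappa> T0\<close> is feasible,
  \<open>Tr (L T) \<le> \<kappa> Tr (L T0) \<le> \<kappa> \<epsilon>^2 \<Lambda>\<close>.  Finally \<open>\<mu> (1 - \<langle>t_hat, t0\<rangle>^2) \<le> \<tau> - \<langle>t0, T t0\<rangle>\<close>,
  \<open>\<tau> \<le> d n \<mu>\<close> and \<open>m \<le> norm LG * \<tau>\<close>, so the squared sine of the angle between \<open>t_hat\<close> and \<open>t0\<close> is at
  most \<open>2 d n \<epsilon>^2 \<alpha>2\<close>, which is at most the square of the claimed bound.
\<close>

section \<open>Eigenvalues of symmetric matrices\<close>

lemma symmetric_matrix_inner: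
  fixes A :: "real^'k^'k"
  assumes "transpose A = A"
  shows "x \<bullet> (A *v y) = (A *v x) \<bullet> y"
  by (metis assms dot_lmul_matrix transpose_matrix_vector)

text \<open>A maximizer \<open>v\<close> of the quadratic form on the compact unit sphere of
  \<open>S\<close> is an eigenvector. The residual \<open>y = c *\<^sub>R v - A *v v\<close> stays
  in \<open>S\<close> by invariance, and if it were nonzero, a small step from \<open>v\<close>
  along \<open>- y\<close> would beat the maximum.\<close>

lemma symmetric_invariant_eigenvector:
  fixes A :: "real^'k^'k"
  assumes sym: "transpose A = A" and S: "subspace S" and nz: "S \<noteq> {0}"
    and inv: "\<And>x. x \<in> S \<Longrightarrow> A *v x \<in> S"
  shows "\<exists>v\<in>S. norm v = 1 \<and> (\<exists>c. A *v v = c *\<^sub>R v)"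
proof -
  let ?K = "S \<inter> sphere 0 1"
  let ?f = "\<lambda>x. x \<bullet> (A *v x)"
  obtain u where u: "u \<in> S" "u \<noteq> 0"
    using nz S subspace_0 by blast
  then have "u /\<^sub>R norm u \<in> ?K"
    using S by (simp add: subspace_scale)
  then have ne: "?K \<noteq> {}"
    by blast
  have comp: "compact ?K"
    using closed_subspace[OF S] by (simp add: closed_Int_compact)
  have "continuous_on ?K ?f"
    by (intro continuous_intros matrix_vector_mult_linear_continuous_on)
  then obtain v where v: "v \<in> ?K" and max: "\<And>x. x \<in> ?K \<Longrightarrow> ?f x \<le> ?f v"
    using continuous_attains_sup[OF comp ne] by blast
  define c where "c = ?f v"
  have vS: "v \<in> S" and vv: "v \<bullet> v = 1" and nv: "norm v = 1"
    using v by (auto simp: norm_eq_1)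
  have le: "?f x \<le> c * (x \<bullet> x)" if "x \<in> S" for x
  proof (cases "x = 0")
    case False
    then have "x /\<^sub>R norm x \<in> ?K"
      using that S by (simp add: subspace_scale)
    from max[OF this] have "?f x / (norm x)\<^sup>2 \<le> c"
      by (simp add: c_def matrix_vector_mult_scaleR power2_eq_square divide_inverse mult_ac)
    then show ?thesis
      using False by (simp add: divide_le_eq power2_norm_eq_inner)
  qed simp
  define y where "y = c *\<^sub>R v - A *v v"
  have yS: "y \<in> S"
    unfolding y_def using vS inv S by (simp add: subspace_diff subspace_scale)
  define g where "g = c * (y \<bullet> y) - ?f y"
  have yv: "y \<bullet> y = c * (v \<bullet> y) - y \<bullet> (A *v v)"
    by (subst y_def) (simp add: inner_diff inner_commute)
  \<comment> \<open>This is \<open>le\<close> at \<open>v + t *\<^sub>R y\<close>; the terms free of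
    \<open>t\<close> cancel because \<open>v\<close> attains the value \<open>c\<close>.\<close>
  have quad: "0 \<le> 2 * t * (y \<bullet> y) + t\<^sup>2 * g" for t
  proof -
    have "v + t *\<^sub>R y \<in> S"
      using vS yS S by (simp add: subspace_add subspace_scale)
    from le[OF this] show ?thesis
      using symmetric_matrix_inner[OF sym, of v y]
      by (simp add: matrix_vector_right_distrib matrix_vector_mult_scaleR inner_add_left
          inner_add_right g_def vv yv inner_commute[of "A *v v" y] power2_eq_square algebra_simps
          inner_commute[of y v] flip: c_def)
  qed
  have "y \<bullet> y = 0"
  proof (rule ccontr)
    assume "y \<bullet> y \<noteq> 0"
    then have pos: "y \<bullet> y > 0"
      by simp
    \<comment> \<open>\<open>b\<close> is a positive majorant of \<open>g\<close>, and the
      \<open>t\<close> chosen below minimizes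
      \<open>2 * t * (y \<bullet> y) + t\<^sup>2 * b\<close>.\<close>
    define b where "b = \<bar>g\<bar> + 1"
    have b: "b > 0" "g \<le> b" by (auto simp: b_def)
    define t where "t = - (y \<bullet> y) / b"
    have "2 * t * (y \<bullet> y) + t\<^sup>2 * g \<le> 2 * t * (y \<bullet> y) + t\<^sup>2 * b"
      using b by (intro add_left_mono mult_left_mono) auto
    also have "\<dots> = - ((y \<bullet> y)\<^sup>2 / b)"
      using b by (simp add: t_def power2_eq_square field_simps)
    also have "\<dots> < 0"
      using b pos by simp
    finally show False
      using quad[of t] by simp
  qed
  then have "A *v v = c *\<^sub>R v"
    by (simp add: y_def)
  then show ?thesis
    using vS nv by blast
qed

text \<open>Induction on the dimension: an eigenvector \<open>v\<close> in \<open>S\<close> is split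
  off, and symmetry makes its orthogonal complement within \<open>S\<close> invariant again.\<close>

lemma symmetric_invariant_orthonormal_eigenbasis:
  fixes A :: "real^'k^'k"
  assumes sym: "transpose A = A" and "subspace S"
    and "\<And>x. x \<in> S \<Longrightarrow> A *v x \<in> S"
  shows "\<exists>B. pairwise orthogonal B \<and> (\<forall>b\<in>B. norm b = 1 \<and> (\<exists>c. A *v b = c *\<^sub>R b)) \<and> span B = S"
  using assms(2,3)
proof (induction "dim S" arbitrary: S rule: less_induct)
  case less
  show ?case
  proof (cases "S = {0}")
    case True
    then show ?thesis
      by (intro exI[of _ "{}"]) auto
  next
    case False
    obtain v c where v: "v \<in> S" "norm v = 1" "A *v v = c *\<^sub>R v"
      using symmetric_invariant_eigenvector[OF sym less.prems(1) False less.prems(2)] by auto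
    define S' where "S' = {x\<in>S. v \<bullet> x = 0}"
    have sub: "subspace S'"
      using less.prems(1) by (auto simp: S'_def subspace_def inner_add_right)
    have "v \<notin> S'"
      using v by (simp add: S'_def norm_eq_1)
    then have "S' \<subset> S"
      using v unfolding S'_def by blast
    then have "dim S' < dim S"
      by (metis dim_psubset sub less.prems(1) span_eq_iff)
    moreover have "A *v x \<in> S'" if "x \<in> S'" for x
      using that less.prems(2) symmetric_matrix_inner[OF sym, of v x] v by (simp add: S'_def)
    ultimately obtain B where B: "pairwise orthogonal B"
      "\<forall>b\<in>B. norm b = 1 \<and> (\<exists>c. A *v b = c *\<^sub>R b)" "span B = S'"
      using less.hyps sub by blast
    have orth: "v \<bullet> b = 0" if "b \<in> B" for b
      using that B(3) span_base[of b B] by (auto simp: S'_def)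
    have "S \<subseteq> span (insert v B)"
    proof
      fix x assume x: "x \<in> S"
      have "x - (v \<bullet> x) *\<^sub>R v \<in> S'"
        using x v less.prems(1)
        by (simp add: S'_def subspace_diff subspace_scale inner_diff_right norm_eq_1)
      then show "x \<in> span (insert v B)"
        using B(3) by (auto simp: span_insert)
    qed
    moreover have "span (insert v B) \<subseteq> S"
      using v less.prems(1) B(3) span_superset[of B] by (intro span_minimal) (auto simp: S'_def)
    ultimately show ?thesis
      using B v orth
      by (intro exI[of _ "insert v B"]) (auto simp: pairwise_insert orthogonal_def inner_commute)
  qed
qed

text \<open>The eigenbasis is indexed by \<open>'k\<close> without any order; an ordering enters
  only in the comparison with \<open>eigval\<close>.\<close>

definition eigensystem :: "real^'k^'k \<Rightarrow> ('k \<Rightarrow> real^'k) \<Rightarrow> ('k \<Rightarrow> real) \<Rightarrow> bool"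
  where "eigensystem A v \<mu> \<longleftrightarrow>
    (\<forall>i j. v i \<bullet> v j = (if i = j then 1 else 0)) \<and> (\<forall>i. A *v v i = \<mu> i *\<^sub>R v i)"

lemma symmetric_eigensystem:
  fixes A :: "real^'k^'k"
  assumes "transpose A = A"
  obtains v \<mu> where "eigensystem A v \<mu>"
proof -
  obtain B where B: "pairwise orthogonal B"
    "\<And>b. b \<in> B \<Longrightarrow> norm b = 1 \<and> (\<exists>c. A *v b = c *\<^sub>R b)" "span B = (UNIV :: (real^'k) set)"
    using symmetric_invariant_orthonormal_eigenbasis[OF assms subspace_UNIV] by auto
  have "independent B"
    using B by (intro pairwise_orthogonal_independent) fastforce+
  then have "finite B" "card B = CARD('k)"
    using B(3) dim_eq_card[of B "UNIV :: (real^'k) set"] by (auto simp: finiteI_independent)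
  then obtain v :: "'k \<Rightarrow> real^'k" where v: "bij_betw v UNIV B"
    using finite_same_card_bij[of "UNIV :: 'k set" B] by auto
  have vB: "v i \<in> B" for i
    using v by (auto simp: bij_betw_def)
  then have "\<forall>i. \<exists>c. A *v v i = c *\<^sub>R v i"
    using B(2) by blast
  then obtain \<mu> where "\<And>i. A *v v i = \<mu> i *\<^sub>R v i"
    by metis
  moreover have "v i \<bullet> v j = (if i = j then 1 else 0)" for i j
  proof (cases "i = j")
    case True
    then show ?thesis
      using B(2)[OF vB] by (simp add: norm_eq_1)
  next
    case False
    then have "v i \<noteq> v j"
      using v by (auto simp: bij_betw_def inj_def)
    then show ?thesis
      using False B(1) vB by (auto simp: pairwise_def orthogonal_def)
  qed
  ultimately show ?thesis
    using that[of v \<mu>] by (simp add: eigensystem_def)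
qed

lemma psd_eigensystem:
  assumes "psd A"
  obtains v \<mu> where "eigensystem A v \<mu>"
  using assms symmetric_eigensystem[of A] by (auto simp: psd_def)

section \<open>Characteristic polynomials and similarity\<close>

definition poly_matrix :: "real^'n^'m \<Rightarrow> real poly^'n^'m"
  where "poly_matrix A = (\<chi> i j. [:A $ i $ j:])"

lemma pCons_sum: "[:\<Sum>i\<in>I. f i:] = (\<Sum>i\<in>I. [:f i:])"
proof (induction I rule: infinite_finite_induct)
  case (insert x F)
  then show ?case
    by (metis add_0 add_pCons sum.insert)
qed auto

lemma poly_matrix_mult: "poly_matrix (A ** B) = poly_matrix A ** poly_matrix B"
  by (simp add: poly_matrix_def matrix_matrix_mult_def vec_eq_iff pCons_sum mult.commute)

lemma poly_matrix_mat_1: "poly_matrix (mat 1) = mat 1"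
  by (auto simp: poly_matrix_def mat_def vec_eq_iff one_pCons)

lemma charpoly_eq_det: "charpoly A = det (mat [:0, 1:] - poly_matrix A)"
  by (simp add: charpoly_def poly_matrix_def mat_def minus_vec_def)

lemma mat_mult_commute:
  fixes A :: "'a::comm_ring_1^'n^'n"
  shows "mat c ** A = A ** mat c"
  by (simp add: vec_eq_iff matrix_matrix_mult_def mat_def if_distrib if_distribR mult.commute
      sum.delta cong: if_cong)

lemma matrix_diff_ldistrib:
  fixes A :: "'a::comm_ring_1^'n^'m"
  shows "A ** (B - C) = A ** B - A ** C"
  by (simp add: vec_eq_iff matrix_matrix_mult_def algebra_simps sum_subtractf)

lemma matrix_diff_rdistrib:
  fixes A :: "'a::comm_ring_1^'n^'m"
  shows "(A - B) ** C = A ** C - B ** C"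
  by (simp add: vec_eq_iff matrix_matrix_mult_def algebra_simps sum_subtractf)

text \<open>Over the polynomial ring the scalar matrix \<open>mat [:0, 1:]\<close> commutes with
  \<open>?P\<close>, so the characteristic matrix of \<open>P ** D ** Q\<close> is that of
  \<open>D\<close> multiplied by \<open>?P\<close> and \<open>?Q\<close>, whose determinants have
  product one.\<close>

lemma charpoly_similar:
  fixes P Q D :: "real^'k^'k"
  assumes "P ** Q = mat 1"
  shows "charpoly (P ** D ** Q) = charpoly D"
proof -
  let ?P = "poly_matrix P" and ?Q = "poly_matrix Q"
  have PQ: "?P ** ?Q = mat 1"
    using assms by (metis poly_matrix_mult poly_matrix_mat_1)
  have "mat [:0, 1:] - poly_matrix (P ** D ** Q) = ?P ** (mat [:0, 1:] - poly_matrix D) ** ?Q"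
    by (simp add: matrix_diff_ldistrib matrix_diff_rdistrib poly_matrix_mult)
      (metis PQ mat_mult_commute matrix_mul_assoc matrix_mul_rid)
  then have "charpoly (P ** D ** Q) = det ?P * charpoly D * det ?Q"
    by (simp add: charpoly_eq_det det_mul)
  also have "\<dots> = det (?P ** ?Q) * charpoly D"
    by (simp add: det_mul)
  finally show ?thesis
    by (simp add: PQ)
qed

section \<open>Calculus in an orthonormal eigenbasis\<close>

context
  fixes A :: "real^'k^'k" and v :: "'k \<Rightarrow> real^'k" and \<mu> :: "'k \<Rightarrow> real"
  assumes es: "eigensystem A v \<mu>"
begin

lemma eigensystem_orthonormal: "v i \<bullet> v j = (if i = j then 1 else 0)"
  using es by (simp add: eigensystem_def)

lemma eigensystem_eigenvector: "A *v v i = \<mu> i *\<^sub>R v i"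
  using es by (simp add: eigensystem_def)

lemma eigensystem_norm: "norm (v i) = 1"
  by (simp add: norm_eq_1 eigensystem_orthonormal)

text \<open>Orthonormality makes \<open>transpose P\<close> a left inverse of \<open>P\<close>; for
  square matrices it is then a right inverse, which is completeness of the basis.\<close>

lemma eigensystem_matrix:
  defines "P \<equiv> (\<chi> i j. v j $ i)"
  shows "P ** transpose P = mat 1"
proof -
  have "transpose P ** P = mat 1"
    using eigensystem_orthonormal
    by (simp add: P_def vec_eq_iff matrix_matrix_mult_def transpose_def mat_def inner_vec_def)
  then show ?thesis
    using matrix_left_right_inverse by blast
qed

text \<open>The bridge from eigenvectors to \<open>eigval\<close>, which is defined through roots:
  \<open>P\<close> diagonalizes \<open>A\<close>, and the characteristic polynomial of the diagonal
  matrix splits into linear factors.\<close>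

lemma proots_charpoly_eigensystem: "proots (charpoly A) = image_mset \<mu> (mset_set UNIV)"
proof -
  define P :: "real^'k^'k" where "P = (\<chi> i j. v j $ i)"
  define D :: "real^'k^'k" where "D = (\<chi> i j. if i = j then \<mu> i else 0)"
  have PP: "P ** transpose P = mat 1"
    using eigensystem_matrix by (simp add: P_def)
  have "A ** P = P ** D"
    using eigensystem_eigenvector
    by (simp add: P_def D_def vec_eq_iff matrix_matrix_mult_def matrix_vector_mult_def
        if_distrib cong: if_cong)
  then have "A = P ** D ** transpose P"
    by (metis PP matrix_mul_assoc matrix_mul_rid)
  then have "charpoly A = charpoly D"
    using charpoly_similar[OF PP] by simp
  also have "\<dots> = (\<Prod>i\<in>UNIV. [:- \<mu> i, 1:])"
    by (subst charpoly_eq_det, subst det_diagonal) (auto simp: D_def mat_def poly_matrix_def)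
  finally have "proots (charpoly A) = (\<Sum>i\<in>UNIV. {#\<mu> i#})"
    by (simp add: proots_prod)
  also have "\<dots> = image_mset \<mu> (mset_set UNIV)"
    by (simp add: sum_unfold_sum_mset)
  finally show ?thesis .
qed

lemma eigensystem_expansion: "x = (\<Sum>i\<in>UNIV. (v i \<bullet> x) *\<^sub>R v i)"
proof -
  define P :: "real^'k^'k" where "P = (\<chi> i j. v j $ i)"
  have "x = P *v (transpose P *v x)"
    using eigensystem_matrix by (simp add: P_def matrix_vector_mul_assoc del: transpose_matrix_vector)
  also have "\<dots> = (\<Sum>i\<in>UNIV. (v i \<bullet> x) *\<^sub>R v i)"
    by (simp add: P_def vec_eq_iff matrix_vector_mult_def transpose_def inner_vec_def mult.commute
        del: transpose_matrix_vector)
  finally show ?thesis .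
qed

lemma eigensystem_inner: "x \<bullet> y = (\<Sum>i\<in>UNIV. (v i \<bullet> x) * (v i \<bullet> y))"
  by (subst eigensystem_expansion[of x]) (simp add: inner_sum_left)

lemma eigensystem_quadratic_form: "x \<bullet> (A *v x) = (\<Sum>i\<in>UNIV. \<mu> i * (v i \<bullet> x)\<^sup>2)"
proof -
  have "A *v x = (\<Sum>i\<in>UNIV. (v i \<bullet> x) *\<^sub>R \<mu> i *\<^sub>R v i)"
    by (subst eigensystem_expansion[of x])
      (simp add: linear_sum[OF matrix_vector_mul_linear] matrix_vector_mult_scaleR
        eigensystem_eigenvector)
  then show ?thesis
    by (simp add: inner_sum_right power2_eq_square inner_commute mult_ac)
qed

text \<open>The trace is invariant under conjugation by the orthogonal matrix
  \<open>P\<close>.\<close>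

lemma eigensystem_trace: "trace M = (\<Sum>i\<in>UNIV. v i \<bullet> (M *v v i))"
proof -
  define P :: "real^'k^'k" where "P = (\<chi> i j. v j $ i)"
  have "M = M ** (P ** transpose P)"
    using eigensystem_matrix by (simp add: P_def)
  then have "trace M = trace (transpose P ** (M ** P))"
    by (metis matrix_mul_assoc trace_mul_sym)
  also have "\<dots> = (\<Sum>i\<in>UNIV. v i \<bullet> (M *v v i))"
    by (simp add: trace_def P_def transpose_def matrix_matrix_mult_def matrix_vector_mult_def
        inner_vec_def)
  finally show ?thesis .
qed

text \<open>For positive semidefinite \<open>A\<close> the right-hand side is a nonnegative
  combination of quadratic forms of \<open>M\<close>, so inequalities between quadratic forms pass
  to the traces of the semidefinite program.\<close>

lemma eigensystem_trace_mult: "trace (M ** A) = (\<Sum>i\<in>UNIV. \<mu> i * (v i \<bullet> (M *v v i)))"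
  unfolding eigensystem_trace
  by (simp add: eigensystem_eigenvector matrix_vector_mult_scaleR flip: matrix_vector_mul_assoc)

lemma eigensystem_trace_self: "trace A = (\<Sum>i\<in>UNIV. \<mu> i)"
  unfolding eigensystem_trace by (simp add: eigensystem_eigenvector eigensystem_orthonormal)

lemma eigensystem_psd_nonneg: "psd A \<Longrightarrow> 0 \<le> \<mu> i"
  unfolding psd_def by (metis eigensystem_eigenvector eigensystem_orthonormal inner_scaleR_right mult.right_neutral)

text \<open>Pairing \<open>A *v x\<close> with \<open>v i\<close> isolates
  \<open>\<mu> i * (v i \<bullet> x)\<close>, so a kernel vector has no component along eigenvectors
  with nonzero eigenvalue.\<close>

lemma eigensystem_kernel: "{x. A *v x = 0} = span (v ` {i. \<mu> i = 0})"
proof (intro equalityI subsetI)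
  fix x assume "x \<in> {x. A *v x = 0}"
  then have *: "\<mu> i * (v i \<bullet> x) = 0" for i
  proof -
    have "A *v x = (\<Sum>i\<in>UNIV. (v i \<bullet> x) *\<^sub>R \<mu> i *\<^sub>R v i)"
      by (subst eigensystem_expansion[of x])
        (simp add: linear_sum[OF matrix_vector_mul_linear] matrix_vector_mult_scaleR
          eigensystem_eigenvector)
    then have "v i \<bullet> (A *v x) = (v i \<bullet> x) * \<mu> i"
      by (simp add: inner_sum_right eigensystem_orthonormal if_distrib cong: if_cong)
    then show ?thesis
      using \<open>x \<in> {x. A *v x = 0}\<close> by (simp add: mult.commute)
  qed
  have "(v i \<bullet> x) *\<^sub>R v i \<in> span (v ` {i. \<mu> i = 0})" for i
    using *[of i] by (cases "\<mu> i = 0") (auto simp: span_zero intro: span_scale span_base)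
  then show "x \<in> span (v ` {i. \<mu> i = 0})"
    by (subst eigensystem_expansion[of x]) (auto intro: span_sum)
next
  fix x assume "x \<in> span (v ` {i. \<mu> i = 0})"
  moreover have "span (v ` {i. \<mu> i = 0}) \<subseteq> {x. A *v x = 0}"
    by (rule span_minimal)
      (auto simp: eigensystem_eigenvector subspace_def matrix_vector_right_distrib matrix_vector_mult_scaleR)
  ultimately show "x \<in> {x. A *v x = 0}"
    by blast
qed

lemma eigensystem_dim_kernel: "dim {x. A *v x = 0} = card {i. \<mu> i = 0}"
proof -
  have inj: "inj v"
    by (rule injI) (metis eigensystem_orthonormal zero_neq_one)
  have "independent (v ` {i. \<mu> i = 0})"
    by (intro pairwise_orthogonal_independent)
      (auto simp: pairwise_def orthogonal_def eigensystem_orthonormal,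
        metis eigensystem_orthonormal inner_zero_left zero_neq_one)
  then show ?thesis
    using inj by (simp add: eigensystem_kernel dim_eq_card_independent card_image inj_on_subset)
qed

lemma eigval_eigensystem:
  "sorted (map (eigval A) [1..<Suc CARD('k)])"
  "mset (map (eigval A) [1..<Suc CARD('k)]) = image_mset \<mu> (mset_set UNIV)"
proof -
  define xs where "xs = sorted_list_of_multiset (proots (charpoly A))"
  have ms: "mset xs = image_mset \<mu> (mset_set UNIV)"
    by (simp add: xs_def proots_charpoly_eigensystem)
  then have len: "length xs = CARD('k)"
    by (metis size_mset size_image_mset size_mset_set)
  \<comment> \<open>\<open>eigval\<close> counts from 1 and list positions from 0, hence the range
    starting at 1.\<close>
  have "map (eigval A) [1..<Suc CARD('k)] = xs"
    by (rule nth_equalityI) (simp_all add: len eigval_def del: upt_Suc flip: xs_def)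
  then show "sorted (map (eigval A) [1..<Suc CARD('k)])"
    "mset (map (eigval A) [1..<Suc CARD('k)]) = image_mset \<mu> (mset_set UNIV)"
    using ms by (simp_all add: xs_def del: upt_Suc)
qed

lemma eigval_mono:
  assumes "1 \<le> k" "k \<le> l" "l \<le> CARD('k)"
  shows "eigval A k \<le> eigval A l"
  using sorted_nth_mono[OF eigval_eigensystem(1), of "k - 1" "l - 1"] assms
  by (simp del: upt_Suc)

text \<open>Applied to the predicate of being zero, this counts the indices taken up by the
  kernel.\<close>

lemma eigval_count: "card {k\<in>{1..CARD('k)}. P (eigval A k)} = card {i. P (\<mu> i)}"
proof -
  have "size (filter_mset P (mset (map (eigval A) [1..<Suc CARD('k)]))) = card {i. P (\<mu> i)}"
    unfolding eigval_eigensystem(2) by (simp add: filter_mset_image_mset)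
  then show ?thesis
    by (simp add: filter_mset_image_mset atLeastLessThanSuc_atLeastAtMost del: upt_Suc)
qed

lemma eigval_in_range:
  assumes "1 \<le> k" "k \<le> CARD('k)"
  shows "eigval A k \<in> range \<mu>"
proof -
  have "eigval A k \<in># mset (map (eigval A) [1..<Suc CARD('k)])"
    using assms by (auto simp del: upt_Suc)
  then show ?thesis
    unfolding eigval_eigensystem(2) by simp
qed

lemma range_eigval:
  obtains k where "1 \<le> k" "k \<le> CARD('k)" "\<mu> i = eigval A k"
proof -
  have "\<mu> i \<in># mset (map (eigval A) [1..<Suc CARD('k)])"
    unfolding eigval_eigensystem(2) by simp
  then show ?thesis
    using that by (auto simp del: upt_Suc)
qed

end

section \<open>Bounds on quadratic forms by eigenvalues and traces\<close>

lemma quadratic_form_le_max_eigval: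
  fixes A :: "real^'k^'k"
  assumes "transpose A = A"
  shows "x \<bullet> (A *v x) \<le> eigval A CARD('k) * (x \<bullet> x)"
proof -
  obtain v \<mu> where es: "eigensystem A v \<mu>"
    using assms by (rule symmetric_eigensystem)
  have "\<mu> i \<le> eigval A CARD('k)" for i
    using range_eigval[OF es, of i] eigval_mono[OF es] by (metis le_refl)
  then show ?thesis
    unfolding eigensystem_quadratic_form[OF es] eigensystem_inner[OF es, of x x] sum_distrib_left
    by (intro sum_mono) (simp add: power2_eq_square mult_right_mono)
qed

text \<open>Each diagonal entry is the quadratic form at a standard basis vector.\<close>

lemma trace_le_max_eigval:
  fixes A :: "real^'k^'k"
  assumes "transpose A = A"
  shows "trace A \<le> real CARD('k) * eigval A CARD('k)"
proof -
  have "trace A = (\<Sum>i\<in>UNIV. axis i 1 \<bullet> (A *v axis i 1))"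
    by (simp add: trace_def matrix_vector_mul_component inner_axis inner_axis' matrix_vector_mult_basis column_def)
  also have "\<dots> \<le> (\<Sum>i\<in>(UNIV :: 'k set). eigval A CARD('k))"
    using quadratic_form_le_max_eigval[OF assms, of "axis _ 1"]
    by (intro sum_mono) (simp add: inner_axis_axis)
  finally show ?thesis
    by simp
qed

text \<open>The kernel accounts for exactly the first \<open>r\<close> sorted eigenvalues, so the
  one with index \<open>Suc r\<close> is the smallest nonzero eigenvalue and bounds the form from
  below on the orthogonal complement of the kernel. It is applied with \<open>r\<close> equal to
  \<open>d + 1\<close>, which produces the index \<open>d + 2\<close>.\<close>

lemma eigval_above_kernel:
  fixes A :: "real^'k^'k"
  assumes A: "psd A" and dim: "dim {x. A *v x = 0} = r" and r: "r < CARD('k)"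
  shows eigval_above_kernel_pos: "eigval A (Suc r) > 0"
    and eigval_above_kernel_le:
      "(\<And>y. A *v y = 0 \<Longrightarrow> x \<bullet> y = 0) \<Longrightarrow> eigval A (Suc r) * (x \<bullet> x) \<le> x \<bullet> (A *v x)"
proof -
  obtain v \<mu> where es: "eigensystem A v \<mu>"
    using A by (elim psd_eigensystem)
  let ?Z = "{k\<in>{1..CARD('k)}. eigval A k = 0}"
  have card: "card ?Z = r"
    using eigval_count[OF es, of "\<lambda>x. x = 0"] eigensystem_dim_kernel[OF es] dim by simp
  have nonneg: "0 \<le> eigval A k" if "1 \<le> k" "k \<le> CARD('k)" for k
    using eigval_in_range[OF es that] eigensystem_psd_nonneg[OF es A] by auto
  show "eigval A (Suc r) > 0"
  proof (rule ccontr)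
    assume "\<not> eigval A (Suc r) > 0"
    then have "eigval A k = 0" if "1 \<le> k" "k \<le> Suc r" for k
      using that r nonneg[of k] eigval_mono[OF es, of k "Suc r"] by simp
    \<comment> \<open>That would be \<open>Suc r\<close> zero eigenvalues, one more than the kernel
      dimension.\<close>
    then have "{1..Suc r} \<subseteq> ?Z"
      using r by auto
    from card_mono[OF _ this] card show False
      by simp
  qed
  have le: "eigval A (Suc r) \<le> \<mu> i" if nz: "\<mu> i \<noteq> 0" for i
  proof -
    obtain k where k: "1 \<le> k" "k \<le> CARD('k)" "\<mu> i = eigval A k"
      by (rule range_eigval[OF es])
    have "\<not> k \<le> r"
    proof
      assume "k \<le> r"
      \<comment> \<open>All zero eigenvalues precede the positive one at \<open>k\<close>; but there
        are \<open>r\<close> of them and only \<open>k - 1 < r\<close> indices before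
        \<open>k\<close>.\<close>
      have "?Z \<subseteq> {1..<k}"
      proof
        fix l assume l: "l \<in> ?Z"
        then have "\<not> k \<le> l"
          using eigval_mono[OF es k(1), of l] nonneg[OF k(1,2)] k(3) nz by auto
        then show "l \<in> {1..<k}"
          using l by auto
      qed
      from card_mono[OF _ this] card \<open>k \<le> r\<close> k(1) show False
        by simp
    qed
    then show ?thesis
      using eigval_mono[OF es, of "Suc r" k] k by simp
  qed
  assume orth: "\<And>y. A *v y = 0 \<Longrightarrow> x \<bullet> y = 0"
  have "eigval A (Suc r) * (v i \<bullet> x)\<^sup>2 \<le> \<mu> i * (v i \<bullet> x)\<^sup>2" for i
  proof (cases "\<mu> i = 0")
    case True
    then show ?thesis
      using orth[of "v i"] eigensystem_eigenvector[OF es, of i] by (simp add: inner_commute)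
  next
    case False
    then show ?thesis
      using le by (simp add: mult_right_mono)
  qed
  then show "eigval A (Suc r) * (x \<bullet> x) \<le> x \<bullet> (A *v x)"
    unfolding eigensystem_quadratic_form[OF es] eigensystem_inner[OF es, of x x] sum_distrib_left
    by (intro sum_mono) (simp add: power2_eq_square)
qed

text \<open>In the eigenbasis the form weights the nonnegative eigenvalues by squared coordinates of
  a unit vector, each at most one.\<close>

lemma psd_quadratic_form_le_trace:
  assumes "psd A" "norm x = 1"
  shows "x \<bullet> (A *v x) \<le> trace A"
proof -
  obtain v \<mu> where es: "eigensystem A v \<mu>"
    using assms(1) by (elim psd_eigensystem)
  have "(v i \<bullet> x)\<^sup>2 \<le> 1" for i
    using Cauchy_Schwarz_ineq2[of "v i" x] assms(2) eigensystem_norm[OF es]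
    by (simp add: abs_square_le_1)
  then show ?thesis
    unfolding eigensystem_quadratic_form[OF es] eigensystem_trace_self[OF es]
    using eigensystem_psd_nonneg[OF es assms(1)] by (intro sum_mono) (simp add: mult_left_le)
qed

section \<open>Rank-one matrices and deviation from an eigenvector\<close>

lemma outer_mult_vec: "outer a b *v x = (b \<bullet> x) *\<^sub>R a"
  by (simp add: outer_def vec_eq_iff matrix_vector_mult_def inner_vec_def sum_distrib_left mult_ac)

lemma trace_outer: "trace (outer a b) = a \<bullet> b"
  by (simp add: trace_def outer_def inner_vec_def)

lemma trace_scaleR: "trace (c *\<^sub>R M) = c * trace M" for M :: "real^'k^'k"
  by (simp add: trace_def sum_distrib_left)

lemma transpose_outer: "transpose (outer a b) = outer b a"
  by (simp add: transpose_def outer_def vec_eq_iff mult.commute)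

lemma matrix_mult_outer: "M ** outer a b = outer (M *v a) b"
  by (simp add: outer_def vec_eq_iff matrix_vector_mult_def matrix_matrix_mult_def sum_distrib_left
      mult_ac)

lemma outer_scaleR_left: "outer (c *\<^sub>R a) b = c *\<^sub>R outer a b"
  by (simp add: outer_def vec_eq_iff mult.assoc)

lemma psd_outer: "psd (outer a a)"
  by (simp add: psd_def transpose_outer outer_mult_vec inner_commute)

text \<open>Subtracting the rank-one part of the eigenvector \<open>u\<close> keeps \<open>A\<close> positive semidefinite, so
  the trace of the rest dominates its quadratic form.\<close>
lemma psd_eigenvector_deviation:
  assumes A: "psd A" and u: "norm u = 1" "A *v u = c *\<^sub>R u" and x: "norm x = 1"
  shows "c * (1 - (u \<bullet> x)\<^sup>2) \<le> trace A - x \<bullet> (A *v x)"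
proof -
  define B where "B = A - c *\<^sub>R outer u u"
  have sym: "transpose A = A" and psd: "\<And>y. 0 \<le> y \<bullet> (A *v y)"
    using A by (auto simp: psd_def)
  have B: "B *v y = A *v y - (c * (u \<bullet> y)) *\<^sub>R u" for y
    by (simp add: B_def matrix_vector_mult_diff_rdistrib scaleR_matrix_vector_assoc[symmetric] outer_mult_vec)
  have q: "y \<bullet> (B *v y) = y \<bullet> (A *v y) - c * (u \<bullet> y)\<^sup>2" for y
    by (simp add: B inner_diff_right inner_commute power2_eq_square)
  have "0 \<le> y \<bullet> (B *v y)" for y
  proof -
    \<comment> \<open>\<open>z\<close> is the component of \<open>y\<close> orthogonal to
      \<open>u\<close>; the form of \<open>B\<close> at \<open>y\<close> is the form of
      \<open>A\<close> at \<open>z\<close>.\<close>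
    define z where "z = y - (u \<bullet> y) *\<^sub>R u"
    have "z \<bullet> (A *v z) = y \<bullet> (B *v y)"
      using u symmetric_matrix_inner[OF sym, of u y]
      by (simp add: z_def q matrix_vector_mult_diff_distrib matrix_vector_mult_scaleR
          inner_diff_left inner_diff_right norm_eq_1 power2_eq_square inner_commute[of y u])
    then show ?thesis
      using psd by metis
  qed
  moreover have "transpose B = B"
    using sym by (simp add: B_def transpose_def outer_def vec_eq_iff mult.commute)
  ultimately have "psd B"
    by (simp add: psd_def)
  from psd_quadratic_form_le_trace[OF this x]
  have "x \<bullet> (A *v x) - c * (u \<bullet> x)\<^sup>2 \<le> trace A - c * (u \<bullet> u)"
    unfolding q by (simp add: B_def trace_sub trace_outer trace_scaleR)
  then show ?thesis
    using u by (simp add: norm_eq_1 algebra_simps)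
qed

section \<open>Laplacians and rigidity\<close>

text \<open>The inverse of \<open>stack\<close>, used to read a long vector as a family of
  points.\<close>

definition block :: "real^('n::finite \<times> 'd::finite) \<Rightarrow> 'n \<Rightarrow> real^'d"
  where "block v i = (\<chi> a. v $ (i, a))"

lemma block_stack [simp]: "block (stack t) = t"
  by (simp add: block_def stack_def fun_eq_iff vec_eq_iff)

lemma stack_block [simp]: "stack (block v) = v"
  by (simp add: block_def stack_def vec_eq_iff)

lemma block_inject: "block v = block w \<longleftrightarrow> v = w"
  by (metis stack_block)

lemma block_zero [simp]: "block 0 i = 0"
  by (simp add: block_def vec_eq_iff)

lemma stack_inner: "stack s \<bullet> stack t = (\<Sum>i\<in>UNIV. s i \<bullet> t i)"
  by (simp add: stack_def inner_vec_def sum.cartesian_product flip: UNIV_Times_UNIV)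
    (simp add: case_prod_beta)

lemma inner_block: "v \<bullet> w = (\<Sum>i\<in>UNIV. block v i \<bullet> block w i)"
  using stack_inner[of "block v" "block w"] by simp

lemma norm_block: "v \<bullet> v = (\<Sum>i\<in>UNIV. (norm (block v i))\<^sup>2)"
  by (simp add: inner_block power2_norm_eq_inner)

lemma block_matrix_mult_vec:
  "block (block_matrix B *v v) i = (\<Sum>j\<in>UNIV. B i j *v block v j)"
  by (simp add: block_def block_matrix_def matrix_vector_mult_def vec_eq_iff
      sum.cartesian_product flip: UNIV_Times_UNIV) (simp add: case_prod_beta)

text \<open>Through this form the condition that the trace of \<open>H_matrix ** T\<close> vanishes
  becomes a centring condition on the eigenvectors of \<open>T\<close>.\<close>

lemma H_matrix_quadratic_form:
  "v \<bullet> (H_matrix *v v) = (norm (\<Sum>i\<in>UNIV. block v i))\<^sup>2"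
  by (simp add: inner_block H_matrix_def kron_def block_matrix_mult_vec inner_sum_left
      inner_sum_right power2_norm_eq_inner inner_commute)

section \<open>Orientations and sums over edges\<close>

lemma simple_graph_irrefl: "simple_graph E \<Longrightarrow> {i, j} \<in> E \<Longrightarrow> i \<noteq> j"
  by (auto simp: simple_graph_def)

lemma orientation_imp_edge: "orientation E D \<Longrightarrow> (i, j) \<in> D \<Longrightarrow> {i, j} \<in> E"
  by (auto simp: orientation_def bij_betw_def)

lemma edge_imp_orientation:
  "orientation E D \<Longrightarrow> {i, j} \<in> E \<Longrightarrow> (i, j) \<in> D \<or> (j, i) \<in> D"
  by (fastforce simp: orientation_def bij_betw_def doubleton_eq_iff)

lemma card_orientation: "orientation E D \<Longrightarrow> card D = card E"
  unfolding orientation_def by (rule bij_betw_same_card)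

lemma orientation_antisym:
  assumes "simple_graph E" "orientation E D" "(i, j) \<in> D"
  shows "(j, i) \<notin> D"
proof
  assume "(j, i) \<in> D"
  then have "(i, j) = (j, i)"
    using assms(2,3) unfolding orientation_def bij_betw_def
    by (elim conjE inj_onD) auto
  then show False
    using simple_graph_irrefl[OF assms(1) orientation_imp_edge[OF assms(2,3)]] by simp
qed

text \<open>The ordered pairs of adjacent vertices are \<open>D\<close> together with its reversal,
  and the two are disjoint because there are no loops.\<close>

lemma sum_neighbours:
  fixes E :: "'n::finite set set" and f :: "'n \<Rightarrow> 'n \<Rightarrow> 'a::comm_monoid_add"
  assumes E: "simple_graph E" and D: "orientation E D"
  shows "(\<Sum>i\<in>UNIV. \<Sum>k | {i, k} \<in> E. f i k) = (\<Sum>(i, j)\<in>D. f i j + f j i)"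
proof -
  have "(\<Sum>i\<in>UNIV. \<Sum>k | {i, k} \<in> E. f i k) = (\<Sum>(i, k)\<in>(SIGMA i:UNIV. {k. {i, k} \<in> E}). f i k)"
    by (simp add: sum.Sigma)
  also have "(SIGMA i:UNIV. {k. {i, k} \<in> E}) = D \<union> prod.swap ` D"
    using edge_imp_orientation[OF D] orientation_imp_edge[OF D]
    by (force simp: insert_commute)
  also have "(\<Sum>(i, k)\<in>D \<union> prod.swap ` D. f i k) =
      (\<Sum>(i, k)\<in>D. f i k) + (\<Sum>(i, k)\<in>prod.swap ` D. f i k)"
    using orientation_antisym[OF E D] by (intro sum.union_disjoint) auto
  also have "(\<Sum>(i, k)\<in>prod.swap ` D. f i k) = (\<Sum>(i, j)\<in>D. f j i)"
    by (subst sum.reindex) (auto simp: case_prod_beta)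
  finally show ?thesis
    by (simp add: case_prod_beta sum.distrib)
qed

section \<open>Quadratic forms of Laplacians\<close>

lemma matrix_vector_mult_minus_left: "(- A) *v x = - (A *v x)" for A :: "real^'n^'m"
  by (simp add: vec_eq_iff matrix_vector_mult_def sum_negf)

lemma matrix_vector_mult_sum_left: "(\<Sum>k\<in>K. A k) *v x = (\<Sum>k\<in>K. A k *v x)"
  for A :: "'i \<Rightarrow> real^'n^'m"
  by (induction K rule: infinite_finite_induct)
    (auto simp: matrix_vector_mult_add_rdistrib)

lemma laplacian_mult_vec:
  assumes "simple_graph E"
  shows "block (laplacian E Q *v v) i = (\<Sum>k | {i, k} \<in> E. Q i k *v (block v i - block v k))"
proof -
  \<comment> \<open>For \<open>j = i\<close> the edge test reads \<open>{i} \<in> E\<close>; its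
    failure keeps the diagonal and the off-diagonal case apart.\<close>
  have irr: "{i} \<notin> E"
    using simple_graph_irrefl[OF assms, of i i] by auto
  have "block (laplacian E Q *v v) i =
      (\<Sum>j\<in>UNIV. (if i = j then \<Sum>k | {i, k} \<in> E. Q i k else if {i, j} \<in> E then - Q i j else 0) *v block v j)"
    by (simp add: laplacian_def block_matrix_mult_vec)
  also have "\<dots> = (\<Sum>j\<in>UNIV. (if j = i then (\<Sum>k | {i, k} \<in> E. Q i k) *v block v i else 0) -
      (if {i, j} \<in> E then Q i j *v block v j else 0))"
    using irr by (intro sum.cong) (auto simp: matrix_vector_mult_minus_left)
  also have "\<dots> = (\<Sum>k | {i, k} \<in> E. Q i k) *v block v i - (\<Sum>k | {i, k} \<in> E. Q i k *v block v k)"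
    by (simp add: sum_subtractf sum.If_cases Collect_conj_eq)
  also have "(\<Sum>k | {i, k} \<in> E. Q i k) *v block v i = (\<Sum>k | {i, k} \<in> E. Q i k *v block v i)"
    by (rule matrix_vector_mult_sum_left)
  finally show ?thesis
    by (simp add: sum_subtractf matrix_vector_mult_diff_distrib)
qed

text \<open>Summation by parts: each edge contributes once from either endpoint, and the symmetry of
  \<open>Q\<close> merges the two contributions into a form in the difference.\<close>

lemma laplacian_quadratic_form:
  assumes E: "simple_graph E" and D: "orientation E D"
    and Q: "\<And>i j. {i, j} \<in> E \<Longrightarrow> Q j i = Q i j"
  shows "v \<bullet> (laplacian E Q *v v) =
    (\<Sum>(i, j)\<in>D. (block v i - block v j) \<bullet> (Q i j *v (block v i - block v j)))"
proof -
  have "v \<bullet> (laplacian E Q *v v) =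
      (\<Sum>i\<in>UNIV. \<Sum>k | {i, k} \<in> E. block v i \<bullet> (Q i k *v (block v i - block v k)))"
    by (simp add: inner_block[of v] laplacian_mult_vec[OF E] inner_sum_right)
  also have "\<dots> = (\<Sum>(i, j)\<in>D. block v i \<bullet> (Q i j *v (block v i - block v j)) +
      block v j \<bullet> (Q j i *v (block v j - block v i)))"
    by (rule sum_neighbours[OF E D])
  also have "\<dots> = (\<Sum>(i, j)\<in>D. (block v i - block v j) \<bullet> (Q i j *v (block v i - block v j)))"
    using Q orientation_imp_edge[OF D]
    by (intro sum.cong) (auto simp: matrix_vector_mult_diff_distrib inner_diff_left inner_diff_right)
  finally show ?thesis .
qed

lemma transpose_laplacian:
  assumes "\<And>i j. {i, j} \<in> E \<Longrightarrow> Q j i = Q i j" "\<And>i j. {i, j} \<in> E \<Longrightarrow> transpose (Q i j) = Q i j"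
  shows "transpose (laplacian E Q) = laplacian E Q"
proof -
  have Qs: "Q i j $ b $ a = Q i j $ a $ b" if "{i, j} \<in> E" for i j a b
  proof -
    have "transpose (Q i j) $ a $ b = Q i j $ a $ b"
      by (simp only: assms(2)[OF that])
    then show ?thesis
      by (simp add: transpose_def)
  qed
  have "laplacian E Q $ (j, b) $ (i, a) = laplacian E Q $ (i, a) $ (j, b)" for i j a b
  proof (cases "i = j")
    case True
    then show ?thesis
      by (auto simp: laplacian_def block_matrix_def intro!: sum.cong Qs)
  next
    case False
    then show ?thesis
      by (cases "{i, j} \<in> E")
        (simp_all add: laplacian_def block_matrix_def insert_commute[of j i] Qs assms(1))
  qed
  then show ?thesis
    by (simp add: transpose_def vec_eq_iff)
qed

text \<open>This makes the quadratic form of a constraint an instance of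
  \<open>laplacian_quadratic_form\<close> for a one-edge graph.\<close>

lemma constraint_matrix_eq_laplacian:
  assumes "i \<noteq> j"
  shows "constraint_matrix i j = laplacian {{i, j}} (\<lambda>_ _. mat 1)"
proof -
  have "{l. {k, l} = {i, j}} = (if k = i then {j} else if k = j then {i} else {})" for k
    using assms by (auto simp: doubleton_eq_iff)
  then show ?thesis
    using assms unfolding constraint_matrix_def laplacian_def
    by (intro arg_cong[where f = block_matrix] ext) auto
qed

lemma constraint_matrix_quadratic_form:
  assumes "i \<noteq> j"
  shows "v \<bullet> (constraint_matrix i j *v v) = (norm (block v i - block v j))\<^sup>2"
  using assms laplacian_quadratic_form[of "{{i, j}}" "{(i, j)}" "\<lambda>_ _. mat 1" v]
  by (simp add: constraint_matrix_eq_laplacian simple_graph_def orientation_def bij_betw_def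
      power2_norm_eq_inner)

lemma graph_laplacian_mult_vec:
  assumes "simple_graph E"
  shows "(graph_laplacian E *v x) $ i = (\<Sum>k | {i, k} \<in> E. x $ i - x $ k)"
proof -
  \<comment> \<open>The degree counts incident edges while the claim sums over neighbours;
    \<open>k\<close> corresponds to the edge \<open>{i, k}\<close>.\<close>
  have "{e\<in>E. i \<in> e} = (\<lambda>k. {i, k}) ` {k. {i, k} \<in> E}"
  proof (intro equalityI subsetI)
    fix e assume e: "e \<in> {e\<in>E. i \<in> e}"
    then obtain a b where "e = {a, b}"
      using assms unfolding simple_graph_def card_2_iff by blast
    moreover from this have "i = a \<or> i = b"
      using e by simp
    ultimately obtain k where "e = {i, k}"
      by (auto simp: insert_commute)
    then show "e \<in> (\<lambda>k. {i, k}) ` {k. {i, k} \<in> E}"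
      using e by simp
  qed auto
  moreover have "inj_on (\<lambda>k. {i, k}) {k. {i, k} \<in> E}"
    by (auto simp: inj_on_def doubleton_eq_iff)
  ultimately have "card {e\<in>E. i \<in> e} = card {k. {i, k} \<in> E}"
    by (simp add: card_image)
  then show ?thesis
    by (simp add: graph_laplacian_def degree_matrix_def adjacency_matrix_def matrix_vector_mult_def
        left_diff_distrib sum_subtractf if_distrib[of "\<lambda>c. c * _"] sum.If_cases cong: if_cong)
qed

lemma graph_laplacian_quadratic_form:
  assumes E: "simple_graph E" and D: "orientation E D"
  shows "x \<bullet> (graph_laplacian E *v x) = (\<Sum>(i, j)\<in>D. (x $ i - x $ j)\<^sup>2)"
proof -
  have "x \<bullet> (graph_laplacian E *v x) = (\<Sum>i\<in>UNIV. \<Sum>k | {i, k} \<in> E. x $ i * (x $ i - x $ k))"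
    by (simp add: inner_vec_def graph_laplacian_mult_vec[OF E] sum_distrib_left)
  also have "\<dots> = (\<Sum>(i, j)\<in>D. x $ i * (x $ i - x $ j) + x $ j * (x $ j - x $ i))"
    by (rule sum_neighbours[OF E D])
  finally show ?thesis
    by (simp add: power2_eq_square algebra_simps)
qed

lemma transpose_graph_laplacian: "transpose (graph_laplacian E) = graph_laplacian E"
  by (auto simp: graph_laplacian_def degree_matrix_def adjacency_matrix_def transpose_def vec_eq_iff
      insert_commute)

text \<open>The sum splits by coordinates: for each \<open>a\<close>, the \<open>a\<close>-th
  coordinates of all points form one test vector for the graph Laplacian. The constant
  \<open>c\<close> is left open because it is taken once as the largest eigenvalue and once as the
  Frobenius norm.\<close>

lemma sum_edges_le:
  fixes E :: "'n::finite set set" and v :: "real^('n \<times> 'd::finite)"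
  assumes E: "simple_graph E" and D: "orientation E D"
    and c: "\<And>x. x \<bullet> (graph_laplacian E *v x) \<le> c * (x \<bullet> x)"
  shows "(\<Sum>(i, j)\<in>D. (norm (block v i - block v j))\<^sup>2) \<le> c * (v \<bullet> v)"
proof -
  define x where "x a = (\<chi> i. v $ (i, a))" for a
  have "(\<Sum>(i, j)\<in>D. (norm (block v i - block v j))\<^sup>2) = (\<Sum>(i, j)\<in>D. \<Sum>a\<in>UNIV. (x a $ i - x a $ j)\<^sup>2)"
    unfolding power2_norm_eq_inner by (simp add: inner_vec_def block_def x_def power2_eq_square)
  also have "\<dots> = (\<Sum>a\<in>UNIV. x a \<bullet> (graph_laplacian E *v x a))"
    unfolding graph_laplacian_quadratic_form[OF E D]
    by (simp add: case_prod_beta) (rule sum.swap)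
  also have "\<dots> \<le> (\<Sum>a\<in>UNIV. c * (x a \<bullet> x a))"
    by (intro sum_mono c)
  also have "(\<Sum>a\<in>UNIV. x a \<bullet> x a) = v \<bullet> v"
    unfolding norm_block power2_norm_eq_inner inner_vec_def block_def x_def
    by simp (rule sum.swap)
  then have "(\<Sum>a\<in>UNIV. c * (x a \<bullet> x a)) = c * (v \<bullet> v)"
    by (simp flip: sum_distrib_left)
  finally show ?thesis .
qed

text \<open>Cauchy-Schwarz in every row, then the Euclidean norm over the rows.\<close>

lemma norm_matrix_mult_vec_le: "norm (A *v x) \<le> norm A * norm x" for A :: "real^'n^'m"
proof -
  have "\<bar>(A *v x) $ i\<bar> \<le> norm x * norm (A $ i)" for i
    using Cauchy_Schwarz_ineq2[of "A $ i" x] by (simp add: matrix_vector_mul_component mult.commute)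
  then have "norm (A *v x) \<le> L2_set (\<lambda>i. norm x * norm (A $ i)) UNIV"
    unfolding norm_vec_def by (intro L2_set_mono) auto
  also have "\<dots> = norm A * norm x"
    by (simp add: norm_vec_def[of A] L2_set_right_distrib mult.commute)
  finally show ?thesis .
qed

lemma quadratic_form_le_norm: "x \<bullet> (A *v x) \<le> norm A * (x \<bullet> x)" for A :: "real^'n^'n"
proof -
  have "x \<bullet> (A *v x) \<le> norm x * norm (A *v x)"
    by (rule norm_cauchy_schwarz)
  also have "\<dots> \<le> norm x * (norm A * norm x)"
    by (intro mult_left_mono norm_matrix_mult_vec_le) simp
  finally show ?thesis
    by (simp add: power2_eq_square mult_ac flip: power2_norm_eq_inner)
qed

section \<open>From rigidity of distinct points to a linear statement\<close>

lemma finite_collisions: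
  fixes u w :: "'n::finite \<Rightarrow> 'a::real_vector"
  assumes "inj u"
  shows "finite {s. \<not> inj (\<lambda>i. u i + s *\<^sub>R w i)}"
proof -
  have "finite {s. u i + s *\<^sub>R w i = u j + s *\<^sub>R w j}" (is "finite ?S") if "i \<noteq> j" for i j
  proof -
    \<comment> \<open>Two distinct collision parameters would force \<open>w i = w j\<close>, hence
      \<open>u i = u j\<close>, against injectivity; so each pair collides for at most one
      parameter.\<close>
    have "s = s'" if "s \<in> ?S" "s' \<in> ?S" for s s'
    proof (rule ccontr)
      assume "s \<noteq> s'"
      have "r *\<^sub>R (w i - w j) = u j - u i" if "r \<in> ?S" for r
      proof -
        have "r *\<^sub>R (w i - w j) = (u i + r *\<^sub>R w i) - (u i + r *\<^sub>R w j)"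
          by (simp add: scaleR_right_diff_distrib)
        also have "u i + r *\<^sub>R w i = u j + r *\<^sub>R w j"
          using that by simp
        finally show ?thesis
          by simp
      qed
      from this[OF that(1)] this[OF that(2)] have "(s - s') *\<^sub>R (w i - w j) = 0"
        by (simp add: scaleR_left_diff_distrib)
      then have "w i = w j"
        using \<open>s \<noteq> s'\<close> by simp
      then have "u i = u j"
        using that(1) by (simp only: mem_Collect_eq add_right_cancel)
      then show False
        using assms \<open>i \<noteq> j\<close> by (auto dest: injD)
    qed
    then have "is_singleton ?S" if "?S \<noteq> {}"
      using that by (intro is_singletonI')
    then show ?thesis
      by (metis finite.simps is_singleton_def)
  qed
  then have "finite (\<Union>(i, j)\<in>{(i, j). i \<noteq> j}. {s. u i + s *\<^sub>R w i = u j + s *\<^sub>R w j})"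
    by (intro finite_UN_I) auto
  then show ?thesis
    by (rule finite_subset[rotated]) (auto simp: inj_def)
qed

text \<open>Linearized rigidity: adding a small multiple of \<open>u\<close> to \<open>p\<close> keeps the points distinct.\<close>
lemma parallel_rigid_linear:
  fixes E :: "'n::finite set set"
  assumes p: "parallel_rigid E p" and u: "\<And>i j. {i, j} \<in> E \<Longrightarrow> \<exists>s. u i - u j = s *\<^sub>R (p i - p j)"
  shows "\<exists>c x. \<forall>i. u i = c *\<^sub>R p i + x"
proof -
  have "inj p"
    using p by (simp add: parallel_rigid_def)
  \<comment> \<open>\<open>0\<close> joins the exceptional set because \<open>u\<close> is recovered
    at the end by dividing by \<open>s\<close>.\<close>
  then have "finite (insert 0 {s. \<not> inj (\<lambda>i. p i + s *\<^sub>R u i)})"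
    unfolding finite_insert by (rule finite_collisions)
  then obtain s where s: "s \<noteq> 0" "inj (\<lambda>i. p i + s *\<^sub>R u i)"
    using ex_new_if_finite[OF infinite_UNIV_char_0] by blast
  have "\<exists>r. (p i + s *\<^sub>R u i) - (p j + s *\<^sub>R u j) = r *\<^sub>R (p i - p j)" if ij: "{i, j} \<in> E" for i j
  proof -
    obtain r where r: "u i - u j = r *\<^sub>R (p i - p j)"
      using u[OF ij] by blast
    have "(p i + s *\<^sub>R u i) - (p j + s *\<^sub>R u j) = (p i - p j) + s *\<^sub>R (u i - u j)"
      by (simp add: scaleR_right_diff_distrib)
    also have "\<dots> = (1 + s * r) *\<^sub>R (p i - p j)"
      by (simp add: r scaleR_left_distrib)
    finally show ?thesis ..
  qed
  then obtain c x where cx: "\<And>i. p i + s *\<^sub>R u i = c *\<^sub>R p i + x"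
    using p s(2) unfolding parallel_rigid_def by blast
  have "u i = ((c - 1) / s) *\<^sub>R p i + (1 / s) *\<^sub>R x" for i
  proof -
    have "u i = (1 / s) *\<^sub>R ((p i + s *\<^sub>R u i) - p i)"
      using s(1) by simp
    also have "\<dots> = (1 / s) *\<^sub>R ((c - 1) *\<^sub>R p i + x)"
      by (simp only: cx) (simp add: scaleR_left_diff_distrib)
    finally show ?thesis
      by (simp add: scaleR_right_distrib)
  qed
  then show ?thesis
    by blast
qed

section \<open>Distances to lines through the origin\<close>

lemma inner_mat1_minus_outer: "w \<bullet> ((mat 1 - outer g g) *v w) = (norm w)\<^sup>2 - (g \<bullet> w)\<^sup>2"
  by (simp add: matrix_vector_mult_diff_rdistrib outer_mult_vec inner_diff_right inner_commute
      power2_norm_eq_inner) (simp add: power2_eq_square)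

lemma norm_minus_projection:
  assumes "norm g = 1"
  shows "(norm (w - (g \<bullet> w) *\<^sub>R g))\<^sup>2 = (norm w)\<^sup>2 - (g \<bullet> w)\<^sup>2"
  using assms unfolding power2_norm_eq_inner
  by (simp add: inner_diff_left inner_diff_right norm_eq_1 inner_commute[of w g] power2_eq_square)

lemma inner_square_le:
  assumes "norm g = 1"
  shows "0 \<le> (norm w)\<^sup>2 - (g \<bullet> w)\<^sup>2"
  using zero_le_power2 by (metis norm_minus_projection[OF assms])

text \<open>Pythagoras: replacing the foot of the perpendicular by another point of the line adds a
  square.\<close>

lemma norm_minus_projection_le:
  assumes "norm g = 1"
  shows "(norm w)\<^sup>2 - (g \<bullet> w)\<^sup>2 \<le> (norm (w - s *\<^sub>R g))\<^sup>2"
proof -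
  have "(norm (w - s *\<^sub>R g))\<^sup>2 = (norm w)\<^sup>2 - (g \<bullet> w)\<^sup>2 + (s - g \<bullet> w)\<^sup>2"
    using assms unfolding power2_norm_eq_inner
    by (simp add: inner_diff_left inner_diff_right norm_eq_1 inner_commute[of w g] power2_eq_square
        algebra_simps)
  then show ?thesis
    by simp
qed

text \<open>The distance of \<open>w\<close> to the line of \<open>g\<close> is tested at the point
  \<open>(h \<bullet> w) *\<^sub>R g\<close>. Compared with the foot on the line of
  \<open>h\<close>, this point is off by at most \<open>\<epsilon> * norm w\<close>; the factor 2
  comes from squaring the triangle inequality.\<close>

lemma projection_perturbation:
  assumes g: "norm g = 1" and h: "norm h = 1" and e: "norm (h - g) \<le> \<epsilon>"
  shows "(norm w)\<^sup>2 - (g \<bullet> w)\<^sup>2 \<le> 2 * ((norm w)\<^sup>2 - (h \<bullet> w)\<^sup>2) + 2 * \<epsilon>\<^sup>2 * (norm w)\<^sup>2"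
proof -
  let ?a = "norm (w - (h \<bullet> w) *\<^sub>R h)" and ?b = "\<epsilon> * norm w"
  have "norm (w - (h \<bullet> w) *\<^sub>R g) = norm ((w - (h \<bullet> w) *\<^sub>R h) + (h \<bullet> w) *\<^sub>R (h - g))"
    by (simp add: algebra_simps)
  also have "\<dots> \<le> ?a + \<bar>h \<bullet> w\<bar> * norm (h - g)"
    by (metis norm_triangle_ineq norm_scaleR)
  also have "\<bar>h \<bullet> w\<bar> * norm (h - g) \<le> norm w * \<epsilon>"
    using Cauchy_Schwarz_ineq2[of h w] h e by (intro mult_mono) auto
  finally have "norm (w - (h \<bullet> w) *\<^sub>R g) \<le> ?a + ?b"
    by (simp add: mult.commute)
  then have "(norm (w - (h \<bullet> w) *\<^sub>R g))\<^sup>2 \<le> (?a + ?b)\<^sup>2"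
    by (simp add: power_mono)
  also have "\<dots> \<le> 2 * ?a\<^sup>2 + 2 * ?b\<^sup>2"
    using sum_squares_bound[of ?a ?b] by (simp add: power2_sum)
  finally show ?thesis
    using norm_minus_projection_le[OF g, of w "h \<bullet> w"]
    by (simp add: norm_minus_projection[OF h] power_mult_distrib)
qed

text \<open>A vector on the line of \<open>g\<close> has no distance of its own to contribute, so
  testing at \<open>s *\<^sub>R h\<close> gives the constant 1 in place of 2.\<close>

lemma projection_deviation_le:
  assumes g: "norm g = 1" and h: "norm h = 1" and e: "norm (h - g) \<le> \<epsilon>"
  shows "(norm (s *\<^sub>R g))\<^sup>2 - (h \<bullet> (s *\<^sub>R g))\<^sup>2 \<le> \<epsilon>\<^sup>2 * (norm (s *\<^sub>R g))\<^sup>2"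
proof -
  have "(norm (s *\<^sub>R g))\<^sup>2 - (h \<bullet> (s *\<^sub>R g))\<^sup>2 \<le> (norm (s *\<^sub>R g - s *\<^sub>R h))\<^sup>2"
    by (rule norm_minus_projection_le[OF h])
  also have "\<dots> = s\<^sup>2 * (norm (h - g))\<^sup>2"
    by (simp add: norm_minus_commute power_mult_distrib flip: scaleR_right_diff_distrib)
  also have "\<dots> \<le> s\<^sup>2 * \<epsilon>\<^sup>2"
    using e by (intro mult_left_mono power_mono) auto
  finally show ?thesis
    using g by (simp add: mult.commute)
qed

section \<open>Stability of the semidefinite program\<close>

lemma norm_direction:
  assumes "inj t" "i \<noteq> j"
  shows "norm (direction t i j) = 1"
proof -
  have "t i - t j \<noteq> 0"
    using assms by (auto dest: injD)
  then show ?thesis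
    by (simp add: direction_def)
qed

lemma scaleR_direction: "norm (t i - t j) *\<^sub>R direction t i j = t i - t j"
  by (cases "t i = t j") (simp_all add: direction_def)

lemma direction_swap: "direction t j i = - direction t i j"
  by (simp add: direction_def norm_minus_commute flip: scaleR_minus_right)

lemma outer_direction_swap:
  "outer (direction t j i) (direction t j i) = outer (direction t i j) (direction t i j)"
  by (subst (1 2) direction_swap) (simp add: outer_def)

text \<open>The common shape of \<open>L\<close> and \<open>L0\<close>, with \<open>G\<close>
  supplying the projections onto the lines.\<close>

definition line_laplacian ::
    "'n::finite set set \<Rightarrow> ('n \<Rightarrow> 'n \<Rightarrow> real^'d^'d) \<Rightarrow> real^('n \<times> 'd::finite)^('n \<times> 'd)"
  where "line_laplacian E G = laplacian E (\<lambda>i j. mat 1 - G i j)"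

context
  fixes E :: "'n::finite set set" and D :: "('n \<times> 'n) set"
  assumes E: "simple_graph E" and D: "orientation E D"
begin

lemma line_laplacian_quadratic_form:
  assumes "\<And>i j. {i, j} \<in> E \<Longrightarrow> G j i = G i j" "\<And>i j. (i, j) \<in> D \<Longrightarrow> G i j = outer (g i j) (g i j)"
  shows "v \<bullet> (line_laplacian E G *v v) =
    (\<Sum>(i, j)\<in>D. (norm (block v i - block v j))\<^sup>2 - (g i j \<bullet> (block v i - block v j))\<^sup>2)"
proof -
  have "v \<bullet> (line_laplacian E G *v v) =
      (\<Sum>(i, j)\<in>D. (block v i - block v j) \<bullet> ((mat 1 - G i j) *v (block v i - block v j)))"
    unfolding line_laplacian_def by (rule laplacian_quadratic_form[OF E D]) (simp add: assms(1))
  also have "\<dots> = (\<Sum>(i, j)\<in>D. (norm (block v i - block v j))\<^sup>2 - (g i j \<bullet> (block v i - block v j))\<^sup>2)"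
    by (intro sum.cong) (auto simp: assms(2) inner_mat1_minus_outer)
  finally show ?thesis .
qed

section \<open>The noiseless Laplacian and its kernel\<close>

context
  fixes t :: "'n \<Rightarrow> real^'d::finite" and L0 :: "real^('n \<times> 'd)^('n \<times> 'd)"
  defines "L0 \<equiv> line_laplacian E (\<lambda>i j. outer (direction t i j) (direction t i j))"
  assumes rigid: "parallel_rigid E t" and unit: "norm (stack t) = 1" and centred: "(\<Sum>i\<in>UNIV. t i) = 0"
begin

lemma rigid_norm_direction:
  assumes "{i, j} \<in> E"
  shows "norm (direction t i j) = 1"
  using rigid simple_graph_irrefl[OF E assms] by (simp add: parallel_rigid_def norm_direction)

lemma L0_quadratic_form:
  "v \<bullet> (L0 *v v) =
    (\<Sum>(i, j)\<in>D. (norm (block v i - block v j))\<^sup>2 - (direction t i j \<bullet> (block v i - block v j))\<^sup>2)"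
  unfolding L0_def by (rule line_laplacian_quadratic_form) (simp_all add: outer_direction_swap)

lemma psd_L0: "psd L0"
  unfolding psd_def
proof (intro conjI allI)
  show "transpose L0 = L0"
    unfolding L0_def line_laplacian_def
  proof (rule transpose_laplacian)
    show "transpose (mat 1 - outer g g) = mat 1 - outer g g" for g :: "real^'d"
      by (simp add: transpose_def mat_def outer_def vec_eq_iff mult.commute)
  qed (simp add: outer_direction_swap)
  show "0 \<le> v \<bullet> (L0 *v v)" for v
    unfolding L0_quadratic_form using orientation_imp_edge[OF D]
    by (intro sum_nonneg) (auto intro!: inner_square_le rigid_norm_direction)
qed

text \<open>The form is a sum of squared distances, so on the kernel every edge difference lies on
  its line; linearized rigidity does the rest.\<close>

lemma L0_kernel_blocks:
  assumes "L0 *v v = 0"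
  obtains c x where "\<And>i. block v i = c *\<^sub>R t i + x"
proof -
  have "(\<Sum>(i, j)\<in>D. (norm (block v i - block v j))\<^sup>2 - (direction t i j \<bullet> (block v i - block v j))\<^sup>2) = 0"
    using L0_quadratic_form[of v] assms by simp
  then have zero: "\<forall>(i, j)\<in>D. (norm (block v i - block v j))\<^sup>2 - (direction t i j \<bullet> (block v i - block v j))\<^sup>2 = 0"
    using orientation_imp_edge[OF D]
    by (subst (asm) sum_nonneg_eq_0_iff) (auto intro!: inner_square_le rigid_norm_direction)
  have par: "\<exists>s. block v i - block v j = s *\<^sub>R (t i - t j)" if ij: "(i, j) \<in> D" for i j
  proof -
    let ?w = "block v i - block v j" and ?g = "direction t i j"
    have "norm ?g = 1"
      using ij by (intro rigid_norm_direction orientation_imp_edge[OF D])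
    then have "(norm (?w - (?g \<bullet> ?w) *\<^sub>R ?g))\<^sup>2 = 0"
      using zero ij by (subst norm_minus_projection) auto
    then have "?w = (?g \<bullet> ?w) *\<^sub>R ?g"
      by simp
    then show ?thesis
      unfolding direction_def scaleR_scaleR by blast
  qed
  have "\<exists>s. block v i - block v j = s *\<^sub>R (t i - t j)" if "{i, j} \<in> E" for i j
    using edge_imp_orientation[OF D that]
  proof
    assume "(j, i) \<in> D"
    then obtain s where "block v j - block v i = s *\<^sub>R (t j - t i)"
      using par by blast
    then have "block v i - block v j = s *\<^sub>R (t i - t j)"
      by (metis minus_diff_eq scaleR_minus_right)
    then show ?thesis ..
  qed (rule par)
  then obtain c x where "\<forall>i. block v i = c *\<^sub>R t i + x"
    using parallel_rigid_linear[OF rigid, of "block v"] by blast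
  then show ?thesis
    using that by blast
qed

lemma L0_kernelI:
  assumes "\<And>i. block v i = c *\<^sub>R t i + x"
  shows "L0 *v v = 0"
proof -
  have "(mat 1 - outer (direction t i k) (direction t i k)) *v (block v i - block v k) = 0"
    if "{i, k} \<in> E" for i k
  proof -
    have "block v i - block v k = (c * norm (t i - t k)) *\<^sub>R direction t i k"
      using scaleR_direction[of t i k]
      by (simp add: assms flip: scaleR_scaleR) (simp add: scaleR_right_diff_distrib)
    then show ?thesis
      using rigid_norm_direction[OF that]
      by (simp add: matrix_vector_mult_scaleR matrix_vector_mult_diff_rdistrib outer_mult_vec norm_eq_1)
  qed
  then have "block (L0 *v v) i = 0" for i
    by (simp add: L0_def line_laplacian_def laplacian_mult_vec[OF E])
  then show ?thesis
    by (simp add: fun_eq_iff flip: block_inject)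
qed

lemma L0_mult_stack: "L0 *v stack t = 0"
  by (rule L0_kernelI[where c = 1 and x = 0]) simp

text \<open>\<open>e a\<close> translates all points along the coordinate \<open>a\<close>. Since
  the points are centred, \<open>stack t\<close> is orthogonal to these translations, which gives an
  orthogonal basis of the kernel with \<open>d + 1\<close> elements.\<close>

lemma dim_L0_kernel: "dim {v. L0 *v v = 0} = Suc CARD('d)"
proof -
  define e :: "'d \<Rightarrow> real^('n \<times> 'd)" where "e a = stack (\<lambda>_. axis a 1)" for a
  define B where "B = insert (stack t) (range e)"
  have ee: "e a \<bullet> e b = (if a = b then real CARD('n) else 0)" for a b
    by (simp add: e_def stack_inner inner_axis_axis)
  have "(\<Sum>i\<in>UNIV. t i $ a) = 0" for a
    using arg_cong[OF centred, of "\<lambda>x. x $ a"] by simp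
  then have te: "stack t \<bullet> e a = 0" for a
    by (simp add: e_def stack_inner inner_axis)
  have inj: "inj e"
    by (rule injI) (metis ee of_nat_0_eq_iff zero_less_card_finite less_irrefl)
  have notin: "stack t \<notin> range e"
    using te unit by (metis imageE inner_eq_zero_iff norm_zero zero_neq_one)
  have "independent B"
  proof (rule pairwise_orthogonal_independent)
    show "pairwise orthogonal B"
      using te by (auto simp: B_def pairwise_def orthogonal_def ee inner_commute)
    have "e a \<noteq> 0" for a
      using ee[of a a] by auto
    then show "0 \<notin> B"
      using unit by (auto simp: B_def)
  qed
  moreover have "card B = Suc CARD('d)"
    using notin inj by (simp add: B_def card_image)
  moreover have "{v. L0 *v v = 0} = span B"
  proof (intro equalityI subsetI)
    fix v assume "v \<in> {v. L0 *v v = 0}"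
    then obtain c x where "\<And>i. block v i = c *\<^sub>R t i + x"
      using L0_kernel_blocks by blast
    then have "v = stack (\<lambda>i. c *\<^sub>R t i + x)"
      by (simp add: fun_eq_iff flip: block_inject)
    also have "\<dots> = c *\<^sub>R stack t + (\<Sum>a\<in>UNIV. x $ a *\<^sub>R e a)"
      by (simp add: vec_eq_iff stack_def e_def axis_def if_distrib cong: if_cong)
    also have "\<dots> \<in> span B"
      by (intro span_add span_sum span_scale span_base) (auto simp: B_def)
    finally show "v \<in> span B" .
  next
    fix v assume "v \<in> span B"
    moreover have "L0 *v e a = 0" for a
      by (rule L0_kernelI[where c = 0 and x = "axis a 1"]) (simp add: e_def)
    then have "span B \<subseteq> {v. L0 *v v = 0}"
      by (intro span_minimal)
        (auto simp: B_def L0_mult_stack subspace_def matrix_vector_right_distrib matrix_vector_mult_scaleR)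
    ultimately show "v \<in> {v. L0 *v v = 0}"
      by blast
  qed
  ultimately show ?thesis
    by (simp add: dim_eq_card_independent)
qed

section \<open>The spectral gap above the kernel\<close>

context
  assumes card_d: "CARD('d) \<ge> 2" and card_n: "CARD('n) \<ge> 2"
begin

text \<open>Ensures that the index \<open>d + 2\<close> is at most \<open>d * n\<close>, so that it
  denotes an actual eigenvalue.\<close>

lemma card_large: "Suc CARD('d) < CARD('n \<times> 'd)"
proof -
  have "2 * CARD('d) \<le> CARD('n) * CARD('d)"
    using card_n by (rule mult_right_mono) simp
  then have "Suc CARD('d) < CARD('n) * CARD('d)"
    using card_d by linarith
  then show ?thesis
    by simp
qed

lemma eigval_L0_pos: "eigval L0 (CARD('d) + 2) > 0"
  using eigval_above_kernel_pos[OF psd_L0 dim_L0_kernel card_large] by simp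

text \<open>Without edges \<open>L0\<close> would vanish and its kernel would be too large. The
  result is used for division by \<open>m\<close> and for the minimum in \<kappa>.\<close>

lemma edges_nonempty: "E \<noteq> {}"
proof
  assume "E = {}"
  then have "L0 = 0"
    by (simp add: L0_def line_laplacian_def laplacian_def block_matrix_def vec_eq_iff)
  then have "dim {v. L0 *v v = 0} = CARD('n \<times> 'd)"
    by simp
  then show False
    using dim_L0_kernel card_large by simp
qed

text \<open>Removing the component along \<open>stack t\<close> leaves \<open>r\<close>, which is
  still centred, hence orthogonal to the translations and so to the whole kernel; the form of
  \<open>L0\<close> does not change.\<close>

lemma eigval_L0_le:
  assumes v: "(\<Sum>i\<in>UNIV. block v i) = 0"
  shows "eigval L0 (CARD('d) + 2) * (v \<bullet> v - (stack t \<bullet> v)\<^sup>2) \<le> v \<bullet> (L0 *v v)"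
proof -
  define r where "r = v - (stack t \<bullet> v) *\<^sub>R stack t"
  have sym: "transpose L0 = L0"
    using psd_L0 by (simp add: psd_def)
  have tt: "stack t \<bullet> stack t = 1"
    using unit by (simp add: norm_eq_1)
  have "r \<bullet> y = 0" if y: "L0 *v y = 0" for y
  proof -
    obtain c x where cx: "\<And>i. block y i = c *\<^sub>R t i + x"
      using L0_kernel_blocks[OF y] by blast
    have orth: "w \<bullet> y = c * (w \<bullet> stack t)" if "(\<Sum>i\<in>UNIV. block w i) = 0" for w
      using that by (simp add: inner_block[of w] cx inner_add_right sum.distrib sum_distrib_left
          flip: inner_sum_left)
    show ?thesis
      using orth[OF v] orth[of "stack t"] centred
      by (simp add: r_def inner_diff_left tt inner_commute[of v "stack t"])
  qed
  from eigval_above_kernel_le[OF psd_L0 dim_L0_kernel card_large this]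
  have "eigval L0 (CARD('d) + 2) * (r \<bullet> r) \<le> r \<bullet> (L0 *v r)"
    by simp
  moreover have "r \<bullet> r = v \<bullet> v - (stack t \<bullet> v)\<^sup>2"
    by (simp add: r_def inner_diff_left inner_diff_right tt power2_eq_square inner_commute)
  moreover have "r \<bullet> (L0 *v r) = v \<bullet> (L0 *v v)"
    using symmetric_matrix_inner[OF sym, of "stack t" v]
    by (simp add: r_def matrix_vector_mult_diff_distrib matrix_vector_mult_scaleR L0_mult_stack
        inner_diff_left)
  ultimately show ?thesis
    by simp
qed

lemma eigval_L0_trace_le:
  assumes T: "psd T" "trace (H_matrix ** T) = 0"
  shows "eigval L0 (CARD('d) + 2) * (trace T - stack t \<bullet> (T *v stack t)) \<le> trace (L0 ** T)"
proof -
  obtain v \<tau> where es: "eigensystem T v \<tau>"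
    using T(1) by (elim psd_eigensystem)
  note nonneg = eigensystem_psd_nonneg[OF es T(1)]
  have sum0: "(\<Sum>k\<in>UNIV. \<tau> k * (norm (\<Sum>i\<in>UNIV. block (v k) i))\<^sup>2) = 0"
    using T(2) by (simp add: eigensystem_trace_mult[OF es] H_matrix_quadratic_form)
  \<comment> \<open>A vanishing sum of nonnegative terms has vanishing terms, so every eigenvector
    of \<open>T\<close> with nonzero eigenvalue is centred and \<open>eigval_L0_le\<close> applies
    to it.\<close>
  have z: "\<tau> k * (norm (\<Sum>i\<in>UNIV. block (v k) i))\<^sup>2 = 0" for k
    by (rule sum_nonneg_0[OF finite _ sum0 UNIV_I]) (simp add: nonneg)
  have "eigval L0 (CARD('d) + 2) * (\<tau> k - \<tau> k * (v k \<bullet> stack t)\<^sup>2) \<le> \<tau> k * (v k \<bullet> (L0 *v v k))" for k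
  proof (cases "\<tau> k = 0")
    case False
    then have "(\<Sum>i\<in>UNIV. block (v k) i) = 0"
      using z[of k] by simp
    from mult_left_mono[OF eigval_L0_le[OF this] nonneg[of k]]
    show ?thesis
      by (simp add: eigensystem_orthonormal[OF es] inner_commute algebra_simps)
  qed simp
  then have "(\<Sum>k\<in>UNIV. eigval L0 (CARD('d) + 2) * (\<tau> k - \<tau> k * (v k \<bullet> stack t)\<^sup>2)) \<le>
      (\<Sum>k\<in>UNIV. \<tau> k * (v k \<bullet> (L0 *v v k)))"
    by (intro sum_mono)
  then show ?thesis
    by (simp add: eigensystem_trace_mult[OF es] eigensystem_trace_self[OF es]
        eigensystem_quadratic_form[OF es] sum_subtractf flip: sum_distrib_left)
qed

section \<open>Noisy lines and solutions of the semidefinite program\<close>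

context
  fixes \<epsilon> :: real and g :: "'n \<Rightarrow> 'n \<Rightarrow> real^'d" and G :: "'n \<Rightarrow> 'n \<Rightarrow> real^'d^'d"
    and L :: "real^('n \<times> 'd)^('n \<times> 'd)" and \<Lambda> :: real
  defines "L \<equiv> line_laplacian E G"
    and "\<Lambda> \<equiv> eigval (graph_laplacian E) CARD('n)"
  assumes g: "\<And>i j. (i, j) \<in> D \<Longrightarrow> norm (g i j) = 1 \<and> norm (g i j - direction t i j) \<le> \<epsilon>"
    and G: "\<And>i j. (i, j) \<in> D \<Longrightarrow> G i j = outer (g i j) (g i j) \<and> G j i = G i j"
begin

lemma L_quadratic_form:
  "v \<bullet> (L *v v) =
    (\<Sum>(i, j)\<in>D. (norm (block v i - block v j))\<^sup>2 - (g i j \<bullet> (block v i - block v j))\<^sup>2)"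
  unfolding L_def
proof (rule line_laplacian_quadratic_form)
  show "G j i = G i j" if "{i, j} \<in> E" for i j
    using edge_imp_orientation[OF D that]
  proof
    assume "(i, j) \<in> D"
    from G[OF this] show ?thesis
      by simp
  next
    assume "(j, i) \<in> D"
    from G[OF this] show ?thesis
      by simp
  qed
qed (simp add: G)

lemma sum_edges_le_eigval:
  "(\<Sum>(i, j)\<in>D. (norm (block v i - block v j))\<^sup>2) \<le> \<Lambda> * (v \<bullet> v)" for v :: "real^('n \<times> 'd)"
  unfolding \<Lambda>_def
  by (intro sum_edges_le[OF E D] quadratic_form_le_max_eigval transpose_graph_laplacian)

lemma L0_quadratic_form_le: "v \<bullet> (L0 *v v) \<le> 2 * (v \<bullet> (L *v v)) + 2 * \<epsilon>\<^sup>2 * \<Lambda> * (v \<bullet> v)"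
proof -
  have "v \<bullet> (L0 *v v) \<le> (\<Sum>(i, j)\<in>D.
      2 * ((norm (block v i - block v j))\<^sup>2 - (g i j \<bullet> (block v i - block v j))\<^sup>2) +
      2 * \<epsilon>\<^sup>2 * (norm (block v i - block v j))\<^sup>2)"
    unfolding L0_quadratic_form
  proof (intro sum_mono, clarify)
    fix i j assume ij: "(i, j) \<in> D"
    let ?w = "block v i - block v j"
    show "(norm ?w)\<^sup>2 - (direction t i j \<bullet> ?w)\<^sup>2 \<le>
        2 * ((norm ?w)\<^sup>2 - (g i j \<bullet> ?w)\<^sup>2) + 2 * \<epsilon>\<^sup>2 * (norm ?w)\<^sup>2"
      using g[OF ij] rigid_norm_direction[OF orientation_imp_edge[OF D ij]]
      by (intro projection_perturbation) auto
  qed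
  also have "\<dots> = 2 * (v \<bullet> (L *v v)) + 2 * \<epsilon>\<^sup>2 * (\<Sum>(i, j)\<in>D. (norm (block v i - block v j))\<^sup>2)"
    unfolding L_quadratic_form by (simp add: case_prod_beta sum.distrib sum_distrib_left)
  also have "\<dots> \<le> 2 * (v \<bullet> (L *v v)) + 2 * \<epsilon>\<^sup>2 * (\<Lambda> * (v \<bullet> v))"
    by (intro add_left_mono mult_left_mono sum_edges_le_eigval) simp
  finally show ?thesis
    by (simp add: mult.assoc)
qed

lemma trace_L0_le:
  assumes "psd T"
  shows "trace (L0 ** T) \<le> 2 * trace (L ** T) + 2 * \<epsilon>\<^sup>2 * \<Lambda> * trace T"
proof -
  obtain v \<tau> where es: "eigensystem T v \<tau>"
    using assms by (elim psd_eigensystem)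
  have "(\<Sum>k\<in>UNIV. \<tau> k * (v k \<bullet> (L0 *v v k))) \<le>
      (\<Sum>k\<in>UNIV. \<tau> k * (2 * (v k \<bullet> (L *v v k)) + 2 * \<epsilon>\<^sup>2 * \<Lambda> * (v k \<bullet> v k)))"
    by (intro sum_mono mult_left_mono L0_quadratic_form_le eigensystem_psd_nonneg[OF es assms])
  also have "\<dots> = 2 * (\<Sum>k\<in>UNIV. \<tau> k * (v k \<bullet> (L *v v k))) + 2 * \<epsilon>\<^sup>2 * \<Lambda> * (\<Sum>k\<in>UNIV. \<tau> k)"
    unfolding sum_distrib_left sum.distrib[symmetric]
    by (intro sum.cong) (simp_all add: eigensystem_orthonormal[OF es] algebra_simps)
  finally show ?thesis
    by (simp only: eigensystem_trace_mult[OF es] eigensystem_trace_self[OF es])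
qed

text \<open>Summing the constraints over all edges gives \<open>m\<close> on the left. The
  right-hand side uses the Frobenius norm of the graph Laplacian because this is the norm occurring
  in \<alpha>2.\<close>

lemma card_edges_le_trace:
  assumes T: "sdp_feasible E (T :: real^('n \<times> 'd)^('n \<times> 'd))"
  shows "real (card E) \<le> norm (graph_laplacian E) * trace T"
proof -
  have psd: "psd T"
    using T by (simp add: sdp_feasible_def)
  obtain v \<tau> where es: "eigensystem T v \<tau>"
    using psd by (elim psd_eigensystem)
  have "real (card E) = (\<Sum>(i, j)\<in>D. 1)"
    using card_orientation[OF D] by simp
  also have "\<dots> \<le> (\<Sum>(i, j)\<in>D. \<Sum>k\<in>UNIV. \<tau> k * (norm (block (v k) i - block (v k) j))\<^sup>2)"
  proof (intro sum_mono, clarify)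
    fix i j assume ij: "(i, j) \<in> D"
    then have e: "{i, j} \<in> E"
      by (rule orientation_imp_edge[OF D])
    then have "1 \<le> trace (constraint_matrix i j ** T)"
      using T by (simp add: sdp_feasible_def)
    then show "1 \<le> (\<Sum>k\<in>UNIV. \<tau> k * (norm (block (v k) i - block (v k) j))\<^sup>2)"
      using simple_graph_irrefl[OF E e]
      by (simp add: eigensystem_trace_mult[OF es] constraint_matrix_quadratic_form)
  qed
  also have "\<dots> = (\<Sum>k\<in>UNIV. \<tau> k * (\<Sum>(i, j)\<in>D. (norm (block (v k) i - block (v k) j))\<^sup>2))"
    by (simp add: case_prod_beta sum_distrib_left) (rule sum.swap)
  also have "\<dots> \<le> (\<Sum>k\<in>UNIV. \<tau> k * (norm (graph_laplacian E) * (v k \<bullet> v k)))"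
    by (intro sum_mono mult_left_mono sum_edges_le[OF E D] quadratic_form_le_norm
        eigensystem_psd_nonneg[OF es psd])
  finally show ?thesis
    by (simp add: eigensystem_trace_self[OF es] eigensystem_orthonormal[OF es] mult.commute
        flip: sum_distrib_right)
qed

text \<open>Every difference \<open>t i - t j\<close> lies exactly on its noiseless line, so
  \<open>projection_deviation_le\<close> applies edge by edge.\<close>

lemma L_stack_le: "stack t \<bullet> (L *v stack t) \<le> \<epsilon>\<^sup>2 * \<Lambda>"
proof -
  have "stack t \<bullet> (L *v stack t) \<le> (\<Sum>(i, j)\<in>D. \<epsilon>\<^sup>2 * (norm (t i - t j))\<^sup>2)"
    unfolding L_quadratic_form block_stack
  proof (intro sum_mono, clarify)
    fix i j assume ij: "(i, j) \<in> D"
    show "(norm (t i - t j))\<^sup>2 - (g i j \<bullet> (t i - t j))\<^sup>2 \<le> \<epsilon>\<^sup>2 * (norm (t i - t j))\<^sup>2"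
      using projection_deviation_le[of "direction t i j" "g i j" \<epsilon> "norm (t i - t j)"]
        g[OF ij] rigid_norm_direction[OF orientation_imp_edge[OF D ij]]
      unfolding scaleR_direction by blast
  qed
  also have "\<dots> = \<epsilon>\<^sup>2 * (\<Sum>(i, j)\<in>D. (norm (block (stack t) i - block (stack t) j))\<^sup>2)"
    by (simp add: case_prod_beta sum_distrib_left)
  also have "\<dots> \<le> \<epsilon>\<^sup>2 * (\<Lambda> * (stack t \<bullet> stack t))"
    by (intro mult_left_mono sum_edges_le_eigval) simp
  finally show ?thesis
    using unit by (simp add: norm_eq_1)
qed

text \<open>Scaling by \<kappa> stretches the shortest edge to at least unit length, and centredness
  gives the condition on \<open>H_matrix\<close>.\<close>

lemma sdp_feasible_scaled_location:
  assumes "0 \<le> \<kappa>" "\<And>i j. {i, j} \<in> E \<Longrightarrow> 1 \<le> \<kappa> * (norm (t i - t j))\<^sup>2"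
  shows "sdp_feasible E (\<kappa> *\<^sub>R outer (stack t) (stack t))"
  unfolding sdp_feasible_def
proof (intro conjI allI impI)
  have tr: "trace (M ** (\<kappa> *\<^sub>R outer (stack t) (stack t))) = \<kappa> * (stack t \<bullet> (M *v stack t))" for M
    by (simp add: matrix_mult_outer trace_outer matrix_vector_mult_scaleR inner_commute
        flip: outer_scaleR_left)
  show "1 \<le> trace (constraint_matrix i j ** (\<kappa> *\<^sub>R outer (stack t) (stack t)))" if "{i, j} \<in> E" for i j
    using assms(2)[OF that] simple_graph_irrefl[OF E that]
    by (simp add: tr constraint_matrix_quadratic_form)
  show "trace (H_matrix ** (\<kappa> *\<^sub>R outer (stack t) (stack t))) = 0"
    by (simp add: tr H_matrix_quadratic_form centred)
  show "psd (\<kappa> *\<^sub>R outer (stack t) (stack t))"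
    using psd_outer[of "stack t"] assms(1)
    by (auto simp: psd_def transpose_def vec_eq_iff simp flip: scaleR_matrix_vector_assoc)
qed

lemma trace_L_solution_le:
  assumes T: "sdp_solution E L T" and \<kappa>: "0 \<le> \<kappa>" "\<And>i j. {i, j} \<in> E \<Longrightarrow> 1 \<le> \<kappa> * (norm (t i - t j))\<^sup>2"
  shows "trace (L ** T) \<le> \<kappa> * (\<epsilon>\<^sup>2 * \<Lambda>)"
proof -
  have "trace (L ** T) \<le> trace (L ** (\<kappa> *\<^sub>R outer (stack t) (stack t)))"
    using T sdp_feasible_scaled_location[OF \<kappa>]
    by (simp add: sdp_solution_def is_arg_min_linorder)
  also have "\<dots> = \<kappa> * (stack t \<bullet> (L *v stack t))"
    by (simp add: matrix_mult_outer trace_outer matrix_vector_mult_scaleR inner_commute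
        flip: outer_scaleR_left)
  finally show ?thesis
    using mult_left_mono[OF L_stack_le \<kappa>(1)] by linarith
qed

text \<open>Combines the trace estimates. \<open>K\<close> is any upper bound for the quotient in
  its assumption, so that the factor \<open>sqrt d\<close> of \<alpha>2 can be inserted later; the
  sign of \<Lambda> is recorded for the sign of \<alpha>2.\<close>

lemma top_eigenvector_deviation:
  assumes T: "sdp_solution E L T" and \<kappa>: "0 \<le> \<kappa>" "\<And>i j. {i, j} \<in> E \<Longrightarrow> 1 \<le> \<kappa> * (norm (t i - t j))\<^sup>2"
    and u: "norm u = 1" "T *v u = eigval T CARD('n \<times> 'd) *\<^sub>R u"
    and K: "\<kappa> * norm (graph_laplacian E) / card E \<le> K"
  shows "1 - (u \<bullet> stack t)\<^sup>2 \<le> 2 * real CARD('n \<times> 'd) * \<epsilon>\<^sup>2 * ((K + 1) * (\<Lambda> / eigval L0 (CARD('d) + 2)))"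
    and "0 \<le> \<Lambda>"
proof -
  define \<mu> where "\<mu> = eigval T CARD('n \<times> 'd)"
  define lam where "lam = eigval L0 (CARD('d) + 2)"
  define s where "s = 1 - (u \<bullet> stack t)\<^sup>2"
  define N where "N = real CARD('n \<times> 'd)"
  define \<tau> where "\<tau> = trace T"
  have feas: "sdp_feasible E T"
    using T by (simp add: sdp_solution_def is_arg_min_linorder)
  then have psd: "psd T" and H: "trace (H_matrix ** T) = 0"
    by (simp_all add: sdp_feasible_def)
  have m: "real (card E) > 0"
    using edges_nonempty by (simp add: card_gt_0_iff)
  have "0 < norm (graph_laplacian E) * \<tau>"
    using card_edges_le_trace[OF feas] m by (simp add: \<tau>_def)
  then have \<tau>: "0 < \<tau>"
    by (simp add: zero_less_mult_iff)
  have \<tau>\<mu>: "\<tau> \<le> N * \<mu>"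
    using trace_le_max_eigval[of T] psd by (simp add: psd_def \<tau>_def N_def \<mu>_def)
  have \<mu>: "0 < \<mu>"
    using \<tau> \<tau>\<mu> by (metis N_def less_le_trans of_nat_0_le_iff zero_less_mult_pos2 zero_less_mult_iff not_less)
  have lam: "0 < lam"
    unfolding lam_def by (rule eigval_L0_pos)
  have "0 \<le> (\<Sum>(i, j)\<in>D. (norm (block (stack t) i - block (stack t) j))\<^sup>2)"
    by (intro sum_nonneg) auto
  also have "\<dots> \<le> \<Lambda>"
    using sum_edges_le_eigval[of "stack t"] unit by (simp add: norm_eq_1)
  finally show \<Lambda>: "0 \<le> \<Lambda>" .
  \<comment> \<open>The trace \<tau> is at least \<open>m\<close> over the Frobenius norm, which
    lets the additive \<kappa> be absorbed into a multiple of \<tau>.\<close>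
  have "\<kappa> * card E \<le> \<kappa> * (norm (graph_laplacian E) * \<tau>)"
    using card_edges_le_trace[OF feas] \<kappa>(1) by (intro mult_left_mono) (auto simp: \<tau>_def)
  then have "\<kappa> \<le> \<kappa> * norm (graph_laplacian E) / card E * \<tau>"
    using m by (simp add: field_simps)
  also have "\<dots> \<le> K * \<tau>"
    using K \<tau> by (intro mult_right_mono) auto
  finally have \<kappa>K: "\<kappa> \<le> K * \<tau>" .
  then have K0: "0 \<le> K"
    using \<kappa>(1) \<tau> by (metis order_trans zero_le_mult_iff not_less)
  \<comment> \<open>The chain starts with a factor \<mu> on the left and ends with one on the right,
    through \<open>\<tau> \<le> N * \<mu>\<close>, so the unknown size of \<open>T\<close>
    cancels.\<close>
  have "\<mu> * (lam * s) = lam * (\<mu> * s)"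
    by simp
  also have "\<dots> \<le> lam * (\<tau> - stack t \<bullet> (T *v stack t))"
    using psd_eigenvector_deviation[OF psd u(1) u(2) unit] lam
    by (intro mult_left_mono) (auto simp: s_def \<mu>_def \<tau>_def)
  also have "\<dots> \<le> trace (L0 ** T)"
    unfolding lam_def \<tau>_def by (rule eigval_L0_trace_le[OF psd H])
  also have "\<dots> \<le> 2 * trace (L ** T) + 2 * \<epsilon>\<^sup>2 * \<Lambda> * \<tau>"
    unfolding \<tau>_def by (rule trace_L0_le[OF psd])
  also have "\<dots> \<le> 2 * (\<kappa> * (\<epsilon>\<^sup>2 * \<Lambda>)) + 2 * \<epsilon>\<^sup>2 * \<Lambda> * \<tau>"
    using trace_L_solution_le[OF T \<kappa>] by simp
  also have "\<dots> = 2 * \<epsilon>\<^sup>2 * \<Lambda> * (\<kappa> + \<tau>)"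
    by (simp add: algebra_simps)
  also have "\<dots> \<le> 2 * \<epsilon>\<^sup>2 * \<Lambda> * ((K + 1) * \<tau>)"
    using \<kappa>K \<Lambda> by (intro mult_left_mono) (auto simp: algebra_simps)
  also have "\<dots> \<le> 2 * \<epsilon>\<^sup>2 * \<Lambda> * ((K + 1) * (N * \<mu>))"
    using \<tau>\<mu> K0 \<Lambda> by (intro mult_left_mono) auto
  also have "\<dots> = \<mu> * (2 * N * \<epsilon>\<^sup>2 * (K + 1) * \<Lambda>)"
    by simp
  finally have "lam * s \<le> 2 * N * \<epsilon>\<^sup>2 * (K + 1) * \<Lambda>"
    using \<mu> by simp
  then have "s \<le> 2 * N * \<epsilon>\<^sup>2 * (K + 1) * \<Lambda> / lam"
    using lam by (simp add: pos_le_divide_eq mult.commute)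
  also have "\<dots> = 2 * N * \<epsilon>\<^sup>2 * ((K + 1) * (\<Lambda> / lam))"
    by simp
  finally show "1 - (u \<bullet> stack t)\<^sup>2 \<le>
      2 * real CARD('n \<times> 'd) * \<epsilon>\<^sup>2 * ((K + 1) * (\<Lambda> / eigval L0 (CARD('d) + 2)))"
    by (simp only: s_def N_def lam_def)
qed

end
end
end
end

section \<open>From the angle to the claimed bound\<close>

lemma nearest_multiple:
  fixes u t :: "'a::real_inner"
  assumes "norm u = 1" "norm t = 1"
  shows "is_arg_min (\<lambda>a. norm (a *\<^sub>R u - t)) (\<lambda>_. True) (u \<bullet> t)"
    and "(norm ((u \<bullet> t) *\<^sub>R u - t))\<^sup>2 = 1 - (u \<bullet> t)\<^sup>2"
proof -
  \<comment> \<open>Pythagoras around the foot of the perpendicular from \<open>t\<close>; the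
    remaining constant is the squared sine of the angle.\<close>
  have *: "(norm (a *\<^sub>R u - t))\<^sup>2 = (a - u \<bullet> t)\<^sup>2 + (1 - (u \<bullet> t)\<^sup>2)" for a
    using assms unfolding power2_norm_eq_inner
    by (simp add: inner_diff_left inner_diff_right norm_eq_1 inner_commute[of t u] power2_eq_square
        algebra_simps)
  then show "(norm ((u \<bullet> t) *\<^sub>R u - t))\<^sup>2 = 1 - (u \<bullet> t)\<^sup>2"
    by simp
  have "norm ((u \<bullet> t) *\<^sub>R u - t) \<le> norm (a *\<^sub>R u - t)" for a
    by (rule power2_le_imp_le) (simp_all add: *)
  then show "is_arg_min (\<lambda>a. norm (a *\<^sub>R u - t)) (\<lambda>_. True) (u \<bullet> t)"
    by (simp add: is_arg_min_linorder)
qed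

text \<open>The two factors are compared separately. As \<open>?X \<ge> 2\<close> and
  \<open>pi \<ge> 2\<close>, the chain from \<open>n * d\<close> through \<open>2 * ?X\<close> and
  \<open>?X * ?X\<close> ends below \<open>(pi * ?X / 2)\<^sup>2\<close>; and
  \<open>2 * \<alpha>2\<close> is at most \<open>?S\<^sup>2\<close> since the square root alone
  already dominates it.\<close>

lemma deviation_bound:
  fixes x d n \<epsilon> \<alpha>1 \<alpha>2 :: real
  assumes x: "x\<^sup>2 \<le> 2 * (n * d) * \<epsilon>\<^sup>2 * \<alpha>2" and d: "d \<ge> 2" and n: "n \<ge> 2" and \<epsilon>: "0 \<le> \<epsilon>"
    and \<alpha>: "0 \<le> \<alpha>1" "0 \<le> \<alpha>2"
  shows "x \<le> \<epsilon> * (pi * d * (n - 1) / 2 * (\<alpha>1 + sqrt (\<alpha>1\<^sup>2 + 2 * \<alpha>2)))"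
proof (rule power2_le_imp_le)
  let ?X = "d * (n - 1)" and ?S = "\<alpha>1 + sqrt (\<alpha>1\<^sup>2 + 2 * \<alpha>2)"
  have X: "2 \<le> ?X"
    using mult_mono[of 2 d 1 "n - 1"] d n by simp
  have "n * d \<le> 2 * ?X"
    using d n by (simp add: algebra_simps)
  also have "\<dots> \<le> ?X * ?X"
    using X by (intro mult_right_mono) auto
  also have "\<dots> \<le> (pi * ?X / 2)\<^sup>2"
    using X pi_ge_two mult_right_mono[of 2 pi ?X] by (subst power2_eq_square, intro mult_mono) auto
  finally have nd: "n * d \<le> (pi * ?X / 2)\<^sup>2" .
  have "2 * \<alpha>2 \<le> (sqrt (\<alpha>1\<^sup>2 + 2 * \<alpha>2))\<^sup>2"
    using \<alpha> by simp
  also have "\<dots> \<le> ?S\<^sup>2"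
    using \<alpha> by (intro power_mono) auto
  finally have S: "2 * \<alpha>2 \<le> ?S\<^sup>2" .
  have "x\<^sup>2 \<le> \<epsilon>\<^sup>2 * ((n * d) * (2 * \<alpha>2))"
    using x by (simp add: mult_ac)
  also have "\<dots> \<le> \<epsilon>\<^sup>2 * ((pi * ?X / 2)\<^sup>2 * ?S\<^sup>2)"
    using nd S \<alpha> by (intro mult_left_mono mult_mono) auto
  finally show "x\<^sup>2 \<le> (\<epsilon> * (pi * d * (n - 1) / 2 * ?S))\<^sup>2"
    by (simp add: power_mult_distrib power_divide mult.assoc)
  show "0 \<le> \<epsilon> * (pi * d * (n - 1) / 2 * ?S)"
    using assms by simp
qed

theorem corollary2p4:
  fixes E :: "'n::finite set set"
    and D :: "('n \<times> 'n) set"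
    and t0 :: "'n \<Rightarrow> real^'d::finite"
    and \<gamma> err :: "'n \<Rightarrow> 'n \<Rightarrow> real^'d"
    and \<Gamma> :: "'n \<Rightarrow> 'n \<Rightarrow> real^'d^'d"
    and T0 L L0 T :: "real^('n \<times> 'd)^('n \<times> 'd)"
    and LG :: "real^'n^'n"
    and t_hat :: "real^('n \<times> 'd)"
    and \<epsilon> d n m \<kappa> \<alpha>1 \<alpha>2 :: real
  assumes "d = real CARD('d)" and "n = real CARD('n)" and "m = real (card E)"
    and "CARD('d) \<ge> 2" and "CARD('n) \<ge> 2"
    and "simple_graph E" and "orientation E D"
    and "T0 = outer (stack t0) (stack t0)"
    and "\<exists>p c x. generic p \<and> c \<noteq> 0 \<and> (\<forall>i. t0 i = c *\<^sub>R p i + x)"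
    and "trace T0 = 1" and "trace (H_matrix ** T0) = 0"
    and "parallel_rigid E t0"
    and "\<epsilon> \<ge> 0"
    and "\<forall>(i, j)\<in>D. \<gamma> i j = direction t0 i j + err i j \<and> norm (err i j) \<le> \<epsilon> \<and> norm (\<gamma> i j) = 1"
    and "\<forall>(i, j)\<in>D. \<Gamma> i j = outer (\<gamma> i j) (\<gamma> i j) \<and> \<Gamma> j i = \<Gamma> i j"
    and "L = laplacian E (\<lambda>i j. mat 1 - \<Gamma> i j)"
    and "L0 = laplacian E (\<lambda>i j. mat 1 - outer (direction t0 i j) (direction t0 i j))"
    and "LG = graph_laplacian E"
    and "sdp_solution E L T"
    and "norm t_hat = 1" and "T *v t_hat = eigval T (CARD('n) * CARD('d)) *\<^sub>R t_hat"
    and "\<kappa> = inverse (Min {(norm (t0 i - t0 j))\<^sup>2 | i j. {i, j} \<in> E})"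
    and "\<alpha>1 = sqrt 2 * m / eigval L0 (CARD('d) + 2)"
    and "\<alpha>2 = (\<kappa> * sqrt d * norm LG / m + 1) * (eigval LG CARD('n) / eigval L0 (CARD('d) + 2))"
  shows "\<exists>a. is_arg_min (\<lambda>a. norm (a *\<^sub>R t_hat - stack t0)) (\<lambda>_. True) a \<and>
    norm (a *\<^sub>R t_hat - stack t0) \<le> \<epsilon> * (pi * d * (n - 1) / 2 * (\<alpha>1 + sqrt (\<alpha>1\<^sup>2 + 2 * \<alpha>2)))"
proof -
  have inj: "inj t0"
    using \<open>parallel_rigid E t0\<close> by (simp add: parallel_rigid_def)
  have unit: "norm (stack t0) = 1"
    using \<open>trace T0 = 1\<close> \<open>T0 = _\<close> by (simp add: trace_outer norm_eq_1)
  \<comment> \<open>The trace against a rank-one matrix is the quadratic form of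
    \<open>H_matrix\<close> at \<open>stack t0\<close>.\<close>
  have "(norm (\<Sum>i\<in>UNIV. t0 i))\<^sup>2 = 0"
    using \<open>trace (H_matrix ** T0) = 0\<close> H_matrix_quadratic_form[of "stack t0"]
    by (simp add: \<open>T0 = _\<close> matrix_mult_outer trace_outer inner_commute)
  then have centred: "(\<Sum>i\<in>UNIV. t0 i) = 0"
    by simp
  note E = \<open>simple_graph E\<close> and D = \<open>orientation E D\<close>
  note rigid = E D \<open>parallel_rigid E t0\<close> unit centred \<open>CARD('d) \<ge> 2\<close> \<open>CARD('n) \<ge> 2\<close>
  have m: "m > 0"
    using edges_nonempty[OF rigid] by (simp add: \<open>m = _\<close> card_gt_0_iff)
  have lam: "eigval L0 (CARD('d) + 2) > 0"
    using eigval_L0_pos[OF rigid] by (simp add: \<open>L0 = _\<close> line_laplacian_def)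
  let ?S = "{(norm (t0 i - t0 j))\<^sup>2 | i j. {i, j} \<in> E}"
  have "?S = (\<lambda>(i, j). (norm (t0 i - t0 j))\<^sup>2) ` {(i, j). {i, j} \<in> E}"
    by auto
  then have fin: "finite ?S"
    by simp
  obtain e where "e \<in> E"
    using edges_nonempty[OF rigid] by blast
  then obtain a b where "{a, b} \<in> E"
    using E unfolding simple_graph_def card_2_iff by metis
  then have "(norm (t0 a - t0 b))\<^sup>2 \<in> ?S"
    by blast
  \<comment> \<open>The minimum is attained at an edge, whose endpoints differ, so it is positive
    and \<kappa> is a genuine reciprocal, not the default \<open>inverse 0 = 0\<close>.\<close>
  then have "Min ?S \<in> ?S"
    using Min_in[OF fin] by blast
  then obtain i j where ij: "{i, j} \<in> E" "Min ?S = (norm (t0 i - t0 j))\<^sup>2"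
    by blast
  have "t0 i \<noteq> t0 j"
    using simple_graph_irrefl[OF E ij(1)] inj by (simp add: inj_eq)
  then have Min: "Min ?S > 0"
    unfolding ij(2) by simp
  then have \<kappa>: "0 \<le> \<kappa>"
    by (simp add: \<open>\<kappa> = _\<close>)
  have \<kappa>1: "1 \<le> \<kappa> * (norm (t0 i - t0 j))\<^sup>2" if "{i, j} \<in> E" for i j
  proof -
    have "Min ?S \<le> (norm (t0 i - t0 j))\<^sup>2"
      using that by (intro Min_le[OF fin]) auto
    then show ?thesis
      using Min by (simp add: \<open>\<kappa> = _\<close> field_simps)
  qed
  have g: "norm (\<gamma> i j) = 1 \<and> norm (\<gamma> i j - direction t0 i j) \<le> \<epsilon>" if "(i, j) \<in> D" for i j
    using \<open>\<forall>(i, j)\<in>D. \<gamma> i j = _ \<and> _\<close> that by fastforce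
  have G: "\<Gamma> i j = outer (\<gamma> i j) (\<gamma> i j) \<and> \<Gamma> j i = \<Gamma> i j" if "(i, j) \<in> D" for i j
    using \<open>\<forall>(i, j)\<in>D. \<Gamma> i j = _ \<and> _\<close> that by blast
  have sol: "sdp_solution E (line_laplacian E \<Gamma>) T"
    using \<open>sdp_solution E L T\<close> by (simp add: \<open>L = _\<close> line_laplacian_def)
  have top: "T *v t_hat = eigval T CARD('n \<times> 'd) *\<^sub>R t_hat"
    using \<open>T *v t_hat = _\<close> by simp
  \<comment> \<open>Since \<open>sqrt d \<ge> 1\<close>, the first summand in \<alpha>2 is
    admissible as the \<open>K\<close> of \<open>top_eigenvector_deviation\<close>.\<close>
  have "\<kappa> * norm LG \<le> \<kappa> * norm LG * sqrt d"
    using mult_left_mono[of 1 "sqrt d" "\<kappa> * norm LG"] \<kappa> \<open>CARD('d) \<ge> 2\<close> by (simp add: \<open>d = _\<close>)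
  then have "\<kappa> * norm (graph_laplacian E) / card E \<le> \<kappa> * sqrt d * norm LG / m"
    using m by (simp add: \<open>LG = _\<close> \<open>m = _\<close> divide_right_mono mult_ac)
  note dev = top_eigenvector_deviation[OF rigid g G sol \<kappa> \<kappa>1 \<open>norm t_hat = 1\<close> top this]
  have "1 - (t_hat \<bullet> stack t0)\<^sup>2 \<le> 2 * (n * d) * \<epsilon>\<^sup>2 * \<alpha>2"
    using dev(1) by (simp add: \<open>n = _\<close> \<open>d = _\<close> \<open>LG = _\<close> \<open>L0 = _\<close> \<open>\<alpha>2 = _\<close> line_laplacian_def)
  moreover have "0 \<le> \<alpha>2"
    using dev(2) lam \<kappa> m by (simp add: \<open>LG = _\<close> \<open>\<alpha>2 = _\<close> \<open>d = _\<close>)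
  moreover have "0 \<le> \<alpha>1"
    using lam m by (simp add: \<open>\<alpha>1 = _\<close>)
  moreover have "d \<ge> 2" "n \<ge> 2"
    using \<open>CARD('d) \<ge> 2\<close> \<open>CARD('n) \<ge> 2\<close> by (simp_all add: \<open>d = _\<close> \<open>n = _\<close>)
  ultimately have "norm ((t_hat \<bullet> stack t0) *\<^sub>R t_hat - stack t0) \<le>
      \<epsilon> * (pi * d * (n - 1) / 2 * (\<alpha>1 + sqrt (\<alpha>1\<^sup>2 + 2 * \<alpha>2)))"
    using nearest_multiple(2)[OF \<open>norm t_hat = 1\<close> unit] \<open>0 \<le> \<epsilon>\<close> by (intro deviation_bound) simp_all
  then show ?thesis
    using nearest_multiple(1)[OF \<open>norm t_hat = 1\<close> unit] by blast
qed

end
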